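(* Let $x \geq 5$ be an integer with $x \equiv 1$ or $5 \pmod 6$. Then there exists a solution to $\mathrm{HWP}(6x;6,2x;1,3x-2)$.
   Context: For integers $M,N \geq 3$ and even $v$, a solution to $\mathrm{HWP}(v;M,N;\alpha,\beta)$ is a decomposition of the edge set of $K_v - F$, for some 1-factor (perfect matching) $F$ of $K_v$, into $\alpha$ $C_M$-factors and $\beta$ $C_N$-factors, where a $C_M$-factor is a spanning subgraph all of whose connected components are cycles of length $M$. *)

theory Defs
  imports Main "HOL-Library.Disjoint_Sets"
begin

text \<open>A simple graph on a vertex set \<open>V\<close> is given by its set \<open>E\<close> of edges, each edge
  being a two-element subset of \<open>V\<close>; a spanning subgraph is a subset of the edge set, with
  the vertex set \<open>V\<close> kept.\<close>

definition complete_edges :: "'a set \<Rightarrow> 'a set set" where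
  "complete_edges V = {e. e \<subseteq> V \<and> card e = 2}"

definition one_factor :: "'a set \<Rightarrow> 'a set set \<Rightarrow> bool" where
  "one_factor V F \<longleftrightarrow> F \<subseteq> complete_edges V \<and> (\<forall>v\<in>V. \<exists>!e. e \<in> F \<and> v \<in> e)"

definition component_of :: "'a set set \<Rightarrow> 'a \<Rightarrow> 'a set" where
  "component_of E v = {(a, b). {a, b} \<in> E}\<^sup>* `` {v}"

definition components :: "'a set \<Rightarrow> 'a set set \<Rightarrow> 'a set set" where
  "components V E = component_of E ` V"

definition is_cycle :: "nat \<Rightarrow> 'a set \<Rightarrow> 'a set set \<Rightarrow> bool" where
  "is_cycle M V E \<longleftrightarrow> 3 \<le> M \<and>
     (\<exists>vs. length vs = M \<and> distinct vs \<and> set vs = V \<and>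
           E = {{vs ! i, vs ! (Suc i mod M)} | i. i < M})"

definition cycle_factor :: "nat \<Rightarrow> 'a set \<Rightarrow> 'a set set \<Rightarrow> bool" where
  "cycle_factor M V E \<longleftrightarrow> E \<subseteq> complete_edges V \<and>
     (\<forall>C\<in>components V E. is_cycle M C {e \<in> E. e \<subseteq> C})"

text \<open>The factors are indexed by \<open>i < \<alpha> + \<beta>\<close>, the first \<open>\<alpha>\<close> of them being the
  \<open>C\<^sub>M\<close>-factors. The vertex set of \<open>K\<^sub>v\<close> is \<open>{..<v}\<close>. Evenness of \<open>v\<close>
  is forced by the 1-factor \<open>F\<close>.\<close>

definition HWP_solution ::
  "nat \<Rightarrow> nat \<Rightarrow> nat \<Rightarrow> nat \<Rightarrow> nat \<Rightarrow> nat set set \<Rightarrow> (nat \<Rightarrow> nat set set) \<Rightarrow> bool" where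
  "HWP_solution v M N \<alpha> \<beta> F G \<longleftrightarrow>
     one_factor {..<v} F \<and>
     (\<forall>i<\<alpha>. cycle_factor M {..<v} (G i)) \<and>
     (\<forall>i\<in>{\<alpha>..<\<alpha> + \<beta>}. cycle_factor N {..<v} (G i)) \<and>
     disjoint_family_on G {..<\<alpha> + \<beta>} \<and>
     (\<Union>i<\<alpha> + \<beta>. G i) = complete_edges {..<v} - F"

end

theory Submission
  imports Defs
begin

text \<open>
  It suffices to find one \<open>C\<^sub>6\<close>-factor and \<open>3x - 2\<close> \<open>C\<^bsub>2x\<^esub>\<close>-factors that are pairwise
  edge-disjoint: every vertex then has degree \<open>6x - 1 - 2(3x - 1) = 1\<close> in the rest, which is
  therefore the 1-factor.

  Split the vertices into six columns, each a copy of \<open>\<int>\<^sub>x\<close>, and take a 1-factorization of \<open>K\<^sub>6\<close>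
  on the columns. One matching of it pairs the columns into three groups of size \<open>2x\<close>; inside the
  groups, Walecki's decomposition of \<open>K\<^bsub>2x\<^esub>\<close> gives \<open>x - 1\<close> factors. Between two columns joined by
  one of the other four matchings, two consecutive differences form a Hamiltonian cycle of
  \<open>K\<^bsub>x,x\<^esub>\<close>; since \<open>x\<close> is odd, this gives \<open>(x - 1)/2\<close> factors per matching and leaves one
  difference for each of 12 pairs of columns. These 12 pairs split into two hexagons of columns.
  The differences left over are chosen such that the first hexagon lifts to a \<open>C\<^sub>6\<close>-factor and the
  second one to a single cycle of length \<open>6x\<close>, which is the cycle \<open>0, 1, \<dots>, 6x - 1\<close>.

  This long cycle is cut into three cycles of length \<open>2x\<close> by exchanging four of its edges with
  four edges of one of the bipartite factors. The first exchange uses the chords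
  \<open>{0, 2x - 1}\<close> and \<open>{6x - 1, 2x}\<close>, which lie between columns joined by one and the same
  matching; it merges two cycles of the bipartite factor. A second exchange, a translate of the
  first by \<open>\<rho>\<close> levels, cuts the remaining \<open>4x\<close>-cycle and splits the merged cycle again. As the
  two bipartite cycles run through their columns in opposite directions, the two parts have
  length \<open>2x\<close> whatever \<open>\<rho>\<close> is.
\<close>

section \<open>Cycle factors\<close>

definition cyc :: "nat \<Rightarrow> (nat \<Rightarrow> 'a) \<Rightarrow> 'a set set" where
  "cyc M f = (\<lambda>i. {f i, f (Suc i mod M)}) ` {..<M}"

lemma Suc_mod_neq:
  assumes "2 \<le> M" "i < M"
  shows "Suc i mod M \<noteq> i"
  using assms by (cases "Suc i = M") auto

lemma rtrancl_cyc:
  assumes "cyc M f \<subseteq> E" "i < M"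
  shows "(f i, f ((i + k) mod M)) \<in> {(a, b). {a, b} \<in> E}\<^sup>*"
proof (induction k)
  case 0
  then show ?case using assms by simp
next
  case (Suc k)
  let ?j = "(i + k) mod M"
  have "?j < M" using assms(2) by simp
  then have "{f ?j, f (Suc ?j mod M)} \<in> E"
    using assms(1) by (auto simp: cyc_def)
  then have "(f ?j, f ((i + Suc k) mod M)) \<in> {(a, b). {a, b} \<in> E}"
    by (simp add: mod_Suc_eq)
  then show ?case using Suc.IH by (rule rtrancl_into_rtrancl[rotated])
qed

text \<open>Since \<open>card V = card T * M\<close>, injectivity of \<open>c\<close> makes it a
  bijection onto \<open>V\<close>. So the cycles are disjoint and cover \<open>V\<close>, and no
  edge of \<open>E\<close> leaves the cycle it starts from: the components are exactly these
  cycles.\<close>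

lemma cycle_factor_UN_cyc:
  assumes "3 \<le> M" "finite V" "card V = card T * M"
    and sub: "\<And>t i. t \<in> T \<Longrightarrow> i < M \<Longrightarrow> c t i \<in> V"
    and eq: "\<And>t i t' i'. c t i = c t' i' \<Longrightarrow> t \<in> T \<Longrightarrow> t' \<in> T \<Longrightarrow> i < M \<Longrightarrow> i' < M
      \<Longrightarrow> t = t' \<and> i = i'"
  shows "cycle_factor M V (\<Union>t\<in>T. cyc M (c t))"
proof -
  define E where "E = (\<Union>t\<in>T. cyc M (c t))"
  have inj: "inj_on (\<lambda>(t, i). c t i) (T \<times> {..<M})"
    using eq by (auto intro!: inj_onI)
  then have cov: "(\<lambda>(t, i). c t i) ` (T \<times> {..<M}) = V"
    using assms(2,3) sub by (intro card_subset_eq) (auto simp: card_image card_cartesian_product)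
  have ME: "M > 0" using assms(1) by simp
  have "E \<subseteq> complete_edges V"
  proof
    fix e assume "e \<in> E"
    then obtain t i where ti: "t \<in> T" "i < M" "e = {c t i, c t (Suc i mod M)}"
      by (auto simp: E_def cyc_def)
    have "c t i \<noteq> c t (Suc i mod M)"
      using eq[of t i t "Suc i mod M"] Suc_mod_neq[of M i] ti assms(1) by auto
    then show "e \<in> complete_edges V"
      using ti sub ME by (simp add: complete_edges_def)
  qed
  moreover have "is_cycle M C {e \<in> E. e \<subseteq> C}" if "C \<in> components V E" for C
  proof -
    from that obtain v where "v \<in> V" and C: "C = component_of E v"
      by (auto simp: components_def)
    then obtain t i where ti: "t \<in> T" "i < M" "v = c t i"
      using cov by auto
    have closed: "b \<in> c t ` {..<M} \<and> {a, b} \<in> cyc M (c t)"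
      if a: "a \<in> c t ` {..<M}" and ab: "{a, b} \<in> E" for a b
    proof -
      obtain t' j where j: "t' \<in> T" "j < M" "{a, b} = {c t' j, c t' (Suc j mod M)}"
        using ab by (auto simp: E_def cyc_def)
      obtain k where k: "k < M" "a = c t k" using a by auto
      have "a = c t' j \<or> a = c t' (Suc j mod M)" using j by auto
      then have "t' = t"
        using eq[of t k t' j] eq[of t k t' "Suc j mod M"] k j ti(1) ME by auto
      then show ?thesis using j ME by (auto simp: cyc_def doubleton_eq_iff)
    qed
    have "w \<in> c t ` {..<M}" if "(v, w) \<in> {(a, b). {a, b} \<in> E}\<^sup>*" for w
      using that
    proof (induction rule: rtrancl_induct)
      case base
      then show ?case using ti by auto
    next
      case (step y z)
      then show ?case using closed by auto
    qed
    then have "C \<subseteq> c t ` {..<M}" by (auto simp: C component_of_def)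
    moreover have "c t ` {..<M} \<subseteq> C"
    proof
      fix w assume "w \<in> c t ` {..<M}"
      then obtain j where j: "j < M" "w = c t j" by auto
      have "(i + (j + M - i)) mod M = j" using ti j by simp
      moreover have "cyc M (c t) \<subseteq> E" using ti by (auto simp: E_def)
      ultimately have "(v, w) \<in> {(a, b). {a, b} \<in> E}\<^sup>*"
        using rtrancl_cyc[of M "c t" E i "j + M - i"] ti j by simp
      then show "w \<in> C" by (auto simp: C component_of_def)
    qed
    ultimately have Ceq: "C = c t ` {..<M}" by blast
    have "{e \<in> E. e \<subseteq> C} = cyc M (c t)"
    proof
      show "{e \<in> E. e \<subseteq> C} \<subseteq> cyc M (c t)"
      proof
        fix e assume e: "e \<in> {e \<in> E. e \<subseteq> C}"
        then obtain a b where "e = {a, b}" by (auto simp: E_def cyc_def)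
        then show "e \<in> cyc M (c t)" using e closed Ceq by auto
      qed
      show "cyc M (c t) \<subseteq> {e \<in> E. e \<subseteq> C}"
        using ti ME by (auto simp: E_def Ceq cyc_def)
    qed
    moreover have "inj_on (c t) {..<M}"
      using eq ti(1) by (auto intro!: inj_onI)
    moreover have "cyc M (c t) =
        {{map (c t) [0..<M] ! i, map (c t) [0..<M] ! (Suc i mod M)} | i. i < M}"
      unfolding cyc_def setcompr_eq_image lessThan_def using ME by (intro image_cong) auto
    ultimately show ?thesis unfolding is_cycle_def
      using assms(1) Ceq
      by (intro conjI exI[of _ "map (c t) [0..<M]"])
         (simp_all add: distinct_map atLeast0LessThan)
  qed
  ultimately show ?thesis by (simp add: cycle_factor_def E_def)
qed

section \<open>Degrees in cycle factors and the complementary 1-factor\<close>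

lemma card_cycle_edges_at:
  assumes "3 \<le> length vs" "distinct vs" "v \<in> set vs"
  shows "card {e. (\<exists>i<length vs. e = {vs ! i, vs ! (Suc i mod length vs)}) \<and> v \<in> e} = 2"
proof -
  define M where "M = length vs"
  have M: "3 \<le> M" using assms M_def by simp
  obtain i where i: "i < M" "v = vs ! i" using assms(3) by (auto simp: in_set_conv_nth M_def)
  \<comment> \<open>The cyclic predecessor of \<open>i\<close>: the edges at \<open>v\<close> are
    those with index \<open>i\<close> and \<open>j\<close>, and they differ because \<open>M\<close>
    is at least 3.\<close>
  define j where "j = (i + M - 1) mod M"
  have j: "j < M" "Suc j mod M = i" using i M by (auto simp: j_def mod_Suc_eq)
  have uniq: "a = b" if "vs ! a = vs ! b" "a < M" "b < M" for a b
    using that assms(2) M_def nth_eq_iff_index_eq by blast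
  have sinj: "k = j" if "Suc k mod M = i" "k < M" for k
    using that j by (cases "Suc k = M"; cases "Suc j = M") auto
  let ?k = "Suc i mod M"
  have k: "?k < M" "?k \<noteq> i" using M i Suc_mod_neq[of M i] by auto
  have "?k \<noteq> j"
  proof
    assume "?k = j"
    then have "Suc (Suc i) mod M = i" using j(2) by (metis mod_Suc_eq)
    then show False using M i(1)
      by (cases "Suc (Suc i) < M"; cases "Suc (Suc i) = M"; cases "Suc i = M")
         (auto simp: mod_Suc)
  qed
  have "{e. (\<exists>i<length vs. e = {vs ! i, vs ! (Suc i mod length vs)}) \<and> v \<in> e}
      = {{vs ! i, vs ! ?k}, {vs ! j, vs ! i}}" (is "?A = ?B")
  proof
    show "?A \<subseteq> ?B"
    proof
      fix e assume "e \<in> ?A"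
      then obtain l where l: "l < M" "e = {vs ! l, vs ! (Suc l mod M)}" "v \<in> e"
        by (auto simp: M_def)
      then have "l = i \<or> Suc l mod M = i"
        using uniq[of i l] uniq[of i "Suc l mod M"] i M by (auto simp: mod_less_divisor)
      then show "e \<in> ?B" using l sinj[of l] i by (auto simp: M_def)
    qed
    show "?B \<subseteq> ?A" using i j by (auto simp: M_def)
  qed
  moreover have "vs ! ?k \<noteq> vs ! j" using uniq[of ?k j] k j \<open>?k \<noteq> j\<close> by auto
  moreover have "vs ! ?k \<noteq> vs ! i" using uniq[of ?k i] k i by auto
  ultimately show ?thesis by (simp add: doubleton_eq_iff)
qed

lemma card_cycle_factor_at:
  assumes "cycle_factor M V E" "v \<in> V"
  shows "card {e \<in> E. v \<in> e} = 2"
proof -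
  define C where "C = component_of E v"
  have vC: "v \<in> C" by (simp add: C_def component_of_def)
  have "C \<in> components V E" using assms(2) by (simp add: C_def components_def)
  then have "is_cycle M C {e \<in> E. e \<subseteq> C}" using assms(1) by (simp add: cycle_factor_def)
  then obtain vs where vs: "3 \<le> M" "length vs = M" "distinct vs" "set vs = C"
    "{e \<in> E. e \<subseteq> C} = {{vs ! i, vs ! (Suc i mod M)} | i. i < M}"
    by (auto simp: is_cycle_def)
  have "e \<subseteq> C" if e: "e \<in> E" "v \<in> e" for e
  proof -
    have "card e = 2" using e assms(1) by (auto simp: cycle_factor_def complete_edges_def)
    then obtain w where "e = {v, w}" using e(2) by (auto simp: card_2_iff)
    moreover from this have "w \<in> C" using e by (auto simp: C_def component_of_def)
    ultimately show ?thesis using vC by auto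
  qed
  then have "{e \<in> E. v \<in> e} = {e \<in> {e \<in> E. e \<subseteq> C}. v \<in> e}" by auto
  also have "\<dots> = {e. (\<exists>i<length vs. e = {vs ! i, vs ! (Suc i mod length vs)}) \<and> v \<in> e}"
    unfolding vs(5) using vs(2) by auto
  finally show ?thesis using card_cycle_edges_at[of vs v] vs vC by simp
qed

lemma card_complete_edges_at:
  assumes "finite V" "v \<in> V"
  shows "card {e \<in> complete_edges V. v \<in> e} = card V - 1"
proof -
  have "{e \<in> complete_edges V. v \<in> e} = (\<lambda>w. {v, w}) ` (V - {v})"
    using assms(2) by (auto simp: complete_edges_def card_2_iff)
  moreover have "inj_on (\<lambda>w. {v, w}) (V - {v})"
    by (auto simp: inj_on_def doubleton_eq_iff)
  ultimately show ?thesis using assms by (simp add: card_image)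
qed

text \<open>Every vertex has degree \<open>2 * card I + 1\<close> in the complete graph, and each of
  the \<open>card I\<close> disjoint factors uses two of these edges, which leaves exactly
  one.\<close>

lemma one_factor_complement:
  assumes "finite V" "finite I" "card V = 2 * card I + 2"
    and cf: "\<And>i. i \<in> I \<Longrightarrow> cycle_factor (M i) V (G i)"
    and dis: "disjoint_family_on G I"
  shows "one_factor V (complete_edges V - (\<Union>i\<in>I. G i))"
proof -
  let ?F = "complete_edges V - (\<Union>i\<in>I. G i)"
  have "\<exists>!e. e \<in> ?F \<and> v \<in> e" if v: "v \<in> V" for v
  proof -
    have fin: "finite (complete_edges V)"
      using assms(1) by (auto simp: complete_edges_def)
    have sub: "G i \<subseteq> complete_edges V" if "i \<in> I" for i
      using cf[OF that] by (simp add: cycle_factor_def)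
    have finG: "finite {e \<in> G i. v \<in> e}" if "i \<in> I" for i
      using sub[OF that] fin by (auto intro: finite_subset)
    have "card (\<Union>i\<in>I. {e \<in> G i. v \<in> e}) = (\<Sum>i\<in>I. card {e \<in> G i. v \<in> e})"
      using dis finG \<open>finite I\<close>
      by (intro card_UN_disjoint) (auto simp: disjoint_family_on_def)
    also have "\<dots> = 2 * card I"
      using card_cycle_factor_at[OF cf v] by simp
    finally have "card (\<Union>i\<in>I. {e \<in> G i. v \<in> e}) = 2 * card I" .
    moreover have "(\<Union>i\<in>I. {e \<in> G i. v \<in> e}) \<subseteq> {e \<in> complete_edges V. v \<in> e}"
      using sub by auto
    moreover have "finite (\<Union>i\<in>I. {e \<in> G i. v \<in> e})"
      using finG \<open>finite I\<close> by simp
    moreover have "{e \<in> ?F. v \<in> e} = {e \<in> complete_edges V. v \<in> e} - (\<Union>i\<in>I. {e \<in> G i. v \<in> e})"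
      by auto
    ultimately have "card {e \<in> ?F. v \<in> e} = 1"
      using card_complete_edges_at[OF assms(1) v] assms(3) by (simp only: card_Diff_subset)
    then obtain e where "{e \<in> ?F. v \<in> e} = {e}"
      by (auto simp: card_1_singleton_iff)
    then show ?thesis by (intro ex1I[of _ e]) blast+
  qed
  then show ?thesis by (simp add: one_factor_def)
qed

lemma HWP_solutionI:
  assumes H: "cycle_factor M {..<v} H"
    and G: "\<And>i. i \<in> I \<Longrightarrow> cycle_factor N {..<v} (G i)"
    and I: "finite I" "card I = n" "v = 2 * n + 4"
    and dis: "disjoint_family_on G I" "\<And>i. i \<in> I \<Longrightarrow> H \<inter> G i = {}"
  shows "\<exists>F G. HWP_solution v M N 1 n F G"
proof -
  obtain h where h: "bij_betw h {0..<n} I"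
    using ex_bij_betw_nat_finite[OF I(1)] I(2) by auto
  define G' where "G' i = (if i = 0 then H else G (h (i - 1)))" for i
  have hI: "h i \<in> I" if "i < n" for i using h that by (auto simp: bij_betw_def)
  have hinj: "i = j" if "h i = h j" "i < n" "j < n" for i j
    using h that by (auto simp: bij_betw_def inj_on_def)
  have cf: "cycle_factor (if i = 0 then M else N) {..<v} (G' i)" if "i < 1 + n" for i
    using that H G hI by (auto simp: G'_def)
  have disj: "disjoint_family_on G' {..<1 + n}"
    unfolding disjoint_family_on_def
  proof (intro ballI impI)
    fix i j assume ij: "i \<in> {..<1 + n}" "j \<in> {..<1 + n}" "i \<noteq> j"
    then have "h (i - 1) \<noteq> h (j - 1)" if "i \<noteq> 0" "j \<noteq> 0"
      using that hinj[of "i - 1" "j - 1"] by (cases i; cases j) auto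
    then show "G' i \<inter> G' j = {}"
      using ij dis hI[of "i - 1"] hI[of "j - 1"]
      by (cases i; cases j) (auto simp: G'_def disjoint_family_on_def)
  qed
  have sub: "(\<Union>i<1 + n. G' i) \<subseteq> complete_edges {..<v}"
    using cf by (force simp: cycle_factor_def)
  have "HWP_solution v M N 1 n (complete_edges {..<v} - (\<Union>i<1 + n. G' i)) G'"
    unfolding HWP_solution_def
  proof (intro conjI)
    show "one_factor {..<v} (complete_edges {..<v} - (\<Union>i<1 + n. G' i))"
      using one_factor_complement[of "{..<v}" "{..<1 + n}" "\<lambda>i. if i = 0 then M else N" G'] cf disj I
      by simp
    show "\<forall>i<1. cycle_factor M {..<v} (G' i)" using cf by (auto simp: G'_def H)
    show "\<forall>i\<in>{1..<1 + n}. cycle_factor N {..<v} (G' i)"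
      using cf by (metis atLeastLessThan_iff not_one_le_zero)
    show "disjoint_family_on G' {..<1 + n}" by fact
    show "(\<Union>i<1 + n. G' i) = complete_edges {..<v} - (complete_edges {..<v} - (\<Union>i<1 + n. G' i))"
      using sub by blast
  qed
  then show ?thesis by blast
qed

section \<open>Columns, levels and differences\<close>

lemma mod_eq_close_imp_eq:
  fixes a b m :: int
  assumes "a mod m = b mod m" "\<bar>a - b\<bar> < m"
  shows "a = b"
proof (rule ccontr)
  assume "a \<noteq> b"
  moreover have "m dvd \<bar>a - b\<bar>" using assms(1) by (simp add: mod_eq_dvd_iff)
  ultimately show False using assms(2) zdvd_imp_le[of m "\<bar>a - b\<bar>"] by auto
qed

text \<open>Four disjoint perfect matchings of the six columns; with \<open>groups\<close> below they form a
  1-factorization of \<open>K\<^sub>6\<close>. The arcs are oriented, since the difference of an edge depends on a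
  direction.\<close>

definition arcs :: "nat \<Rightarrow> (nat \<times> nat) set" where
  "arcs q = (if q = 0 then {(0, 1), (5, 2), (3, 4)}
    else if q = 1 then {(0, 3), (5, 4), (1, 2)}
    else if q = 2 then {(5, 0), (1, 3), (2, 4)}
    else {(5, 1), (0, 4), (2, 3)})"

text \<open>The difference that is left over for the hexagons. The values on \<open>(5, 1)\<close> and \<open>(5, 2)\<close>
  cancel along the hexagon \<open>hex1_arcs\<close>; they are chosen such that the two chords of an exchange
  belong to the same bipartite factor also for \<open>x mod 6 = 1\<close>.\<close>

definition shift :: "nat \<Rightarrow> nat \<Rightarrow> int" where
  "shift i j = (if i = 5 \<and> j = 0 then 1 else if i = 5 \<and> (j = 1 \<or> j = 2) then 2 else 0)"

definition groups :: "(nat \<times> nat) set" where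
  "groups = {(5, 3), (0, 2), (1, 4)}"

definition hex1_arcs :: "(nat \<times> nat) set" where
  "hex1_arcs = {(5, 1), (1, 3), (0, 3), (0, 4), (2, 4), (5, 2)}"

text \<open>Along the closed walk 5, 0, 1, 2, 3, 4, 5 the values of \<open>shift\<close> add up to
  1. Each turn thus rises one level, and the lift is a single cycle of length
  \<open>6 * x\<close>.\<close>

definition hex2_arcs :: "(nat \<times> nat) set" where
  "hex2_arcs = {(5, 0), (0, 1), (1, 2), (2, 3), (3, 4), (5, 4)}"

definition all_arcs :: "(nat \<times> nat) set" where
  "all_arcs = {(0, 1), (5, 2), (3, 4), (0, 3), (5, 4), (1, 2), (5, 0), (1, 3), (2, 4),
    (5, 1), (0, 4), (2, 3)}"

lemma arcs_less:
  assumes "(i, j) \<in> arcs q"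
  shows "i < 6" "j < 6" "i \<noteq> j"
  using assms by (auto simp: arcs_def split: if_splits)

lemma card_arcs: "card (arcs q) = 3"
  by (simp add: arcs_def)

lemma arcs_matching:
  assumes "(i, j) \<in> arcs q" "(i', j') \<in> arcs q" "i = i' \<or> i = j' \<or> j = i' \<or> j = j'"
  shows "i = i' \<and> j = j'"
  using assms by (auto simp: arcs_def split: if_splits)

lemma arcs_disjoint:
  assumes "(i, j) \<in> arcs q" "(i, j) \<in> arcs q'" "q < 4" "q' < 4"
  shows "q = q'"
  using assms by (auto simp: arcs_def split: if_splits)

lemma all_arcs_less:
  assumes "(i, j) \<in> all_arcs"
  shows "i < 6" "j < 6" "(j, i) \<notin> all_arcs"
  using assms unfolding all_arcs_def by (elim insertE emptyE; simp)+

lemma all_arcs_groups: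
  assumes "(i, j) \<in> all_arcs" "(g, h) \<in> groups"
  shows "\<not> (i \<in> {g, h} \<and> j \<in> {g, h})"
  using assms unfolding all_arcs_def groups_def by (elim insertE emptyE; simp)

lemma arcs_subset_all: "arcs q \<subseteq> all_arcs"
  by (simp add: arcs_def all_arcs_def)

lemma hex_arcs_subset: "hex1_arcs \<subseteq> all_arcs" "hex2_arcs \<subseteq> all_arcs" "hex1_arcs \<inter> hex2_arcs = {}"
  by (simp_all add: hex1_arcs_def hex2_arcs_def all_arcs_def)

lemma groups_less:
  assumes "(i, j) \<in> groups"
  shows "i < 6" "j < 6" "i \<noteq> j"
  using assms by (auto simp: groups_def)

lemma card_groups: "card groups = 3"
  by (simp add: groups_def)

lemma groups_matching:
  assumes "(i, j) \<in> groups" "(i', j') \<in> groups" "i = i' \<or> i = j' \<or> j = i' \<or> j = j'"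
  shows "i = i' \<and> j = j'"
  using assms by (auto simp: groups_def)

locale levels =
  fixes x :: nat
  assumes x_ge: "5 \<le> x" and x_odd: "odd x"
begin

text \<open>With the column as residue modulo 6 and the level as quotient, the lift of the second
  hexagon becomes the cycle of consecutive numbers.\<close>

definition vtx :: "nat \<Rightarrow> int \<Rightarrow> nat" where
  "vtx i a = 6 * nat (a mod int x) + i"

lemma vtx_eq_iff:
  assumes "i < 6" "j < 6"
  shows "vtx i a = vtx j b \<longleftrightarrow> i = j \<and> a mod int x = b mod int x"
proof -
  have "0 \<le> a mod int x" "0 \<le> b mod int x" using x_ge by auto
  then have nat_eq: "nat (a mod int x) = nat (b mod int x) \<longleftrightarrow> a mod int x = b mod int x"
    by (simp add: eq_nat_nat_iff)
  have "6 * k + i = 6 * l + j \<longleftrightarrow> i = j \<and> k = l" for k l :: nat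
    using assms by presburger
  then show ?thesis unfolding vtx_def nat_eq[symmetric] by blast
qed

lemma vtx_less:
  assumes "i < 6"
  shows "vtx i a < 6 * x"
proof -
  have "nat (a mod int x) < x" using x_ge by (simp add: nat_less_iff)
  then show ?thesis using assms unfolding vtx_def by linarith
qed

lemma vtx_of_nat: "a < x \<Longrightarrow> vtx i (int a) = 6 * a + i"
  by (simp add: vtx_def)

definition diff_class :: "nat \<Rightarrow> nat \<Rightarrow> int \<Rightarrow> nat set set" where
  "diff_class i j d = {{vtx i a, vtx j b} | a b. (b - a) mod int x = d mod int x}"

lemma diff_classI:
  assumes "(b - a) mod int x = d mod int x"
  shows "{vtx i a, vtx j b} \<in> diff_class i j d" "{vtx j b, vtx i a} \<in> diff_class i j d"
  using assms by (auto simp: diff_class_def insert_commute)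

text \<open>The source of disjointness among bipartite pieces and hexagons. \<open>all_arcs\<close>
  contains no pair of columns in both orientations, so an edge fixes its arc and then its level
  difference.\<close>

lemma diff_class_unique:
  assumes "e \<in> diff_class i j d" "e \<in> diff_class i' j' d'"
    and "(i, j) \<in> all_arcs" "(i', j') \<in> all_arcs"
  shows "i = i' \<and> j = j' \<and> d mod int x = d' mod int x"
proof -
  obtain a b where ab: "e = {vtx i a, vtx j b}" "(b - a) mod int x = d mod int x"
    using assms(1) by (auto simp: diff_class_def)
  obtain a' b' where ab': "e = {vtx i' a', vtx j' b'}" "(b' - a') mod int x = d' mod int x"
    using assms(2) by (auto simp: diff_class_def)
  note less = all_arcs_less[OF assms(3)] all_arcs_less[OF assms(4)]
  have "\<not> (i = j' \<and> j = i')" using assms(4) less(3) by auto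
  then have "vtx i a = vtx i' a' \<and> vtx j b = vtx j' b'"
    using ab(1) ab'(1) less by (auto simp: doubleton_eq_iff vtx_eq_iff)
  then have "i = i'" "j = j'" "a mod int x = a' mod int x" "b mod int x = b' mod int x"
    using less by (auto simp: vtx_eq_iff)
  then show ?thesis using ab(2) ab'(2) by (metis mod_diff_cong)
qed

text \<open>For \<open>m < (x - 1) div 2\<close> the offsets to \<open>shift\<close> run once
  through 1 to \<open>x - 1\<close>; offset 0 is kept for \<open>base_hex\<close>. Disjointness is
  proved for such edge classes, and the factors are located inside them up to the exchange.\<close>

definition base_piece :: "nat \<Rightarrow> nat \<Rightarrow> nat set set" where
  "base_piece q m = (\<Union>(i, j)\<in>arcs q. diff_class i j (shift i j + 2 * int m + 1)
     \<union> diff_class i j (shift i j + 2 * int m + 2))"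

definition base_hex :: "(nat \<times> nat) set \<Rightarrow> nat set set" where
  "base_hex H = (\<Union>(i, j)\<in>H. diff_class i j (shift i j))"

lemma base_pieceE:
  assumes "e \<in> base_piece q m"
  obtains i j D where "(i, j) \<in> arcs q" "D = 2 * m + 1 \<or> D = 2 * m + 2"
    "e \<in> diff_class i j (shift i j + int D)"
proof -
  obtain i j where ij: "(i, j) \<in> arcs q" and
    "e \<in> diff_class i j (shift i j + 2 * int m + 1) \<or> e \<in> diff_class i j (shift i j + 2 * int m + 2)"
    using assms by (auto simp: base_piece_def)
  then have "e \<in> diff_class i j (shift i j + int (2 * m + 1))
      \<or> e \<in> diff_class i j (shift i j + int (2 * m + 2))"
    by (simp add: algebra_simps)
  then show ?thesis using that ij by blast
qed

lemma shift_mod_cancel: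
  assumes "(k + int D) mod int x = (k + int D') mod int x" "D < x" "D' < x"
  shows "D = D'"
  using mod_eq_close_imp_eq[OF assms(1)] assms(2,3) by auto

lemma base_piece_disjoint:
  assumes "e \<in> base_piece q m" "e \<in> base_piece q' m'"
    and "q < 4" "q' < 4" "m < (x - 1) div 2" "m' < (x - 1) div 2"
  shows "q = q' \<and> m = m'"
proof -
  obtain i j D where 1: "(i, j) \<in> arcs q" "D = 2 * m + 1 \<or> D = 2 * m + 2"
    "e \<in> diff_class i j (shift i j + int D)"
    using assms(1) by (rule base_pieceE)
  obtain i' j' D' where 2: "(i', j') \<in> arcs q'" "D' = 2 * m' + 1 \<or> D' = 2 * m' + 2"
    "e \<in> diff_class i' j' (shift i' j' + int D')"
    using assms(2) by (rule base_pieceE)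
  have eq: "i = i'" "j = j'" "(shift i j + int D) mod int x = (shift i' j' + int D') mod int x"
    using diff_class_unique[OF 1(3) 2(3)] 1(1) 2(1) arcs_subset_all assms by blast+
  then have "q = q'" using arcs_disjoint 1 2 assms by blast
  moreover have "D < x" "D' < x" using 1(2) 2(2) assms by auto
  then have "D = D'" using shift_mod_cancel[of "shift i j" D D'] eq by auto
  then have "m = m'" using 1(2) 2(2) by presburger
  ultimately show ?thesis by simp
qed

lemma base_piece_hex_disjoint:
  assumes "e \<in> base_piece q m" "e \<in> base_hex H" "H \<subseteq> all_arcs" "q < 4" "m < (x - 1) div 2"
  shows False
proof -
  obtain i j D where 1: "(i, j) \<in> arcs q" "D = 2 * m + 1 \<or> D = 2 * m + 2"
    "e \<in> diff_class i j (shift i j + int D)"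
    using assms(1) by (rule base_pieceE)
  obtain i' j' where 2: "(i', j') \<in> H" "e \<in> diff_class i' j' (shift i' j')"
    using assms(2) by (auto simp: base_hex_def)
  have eq: "i = i'" "j = j'" "(shift i j + int D) mod int x = shift i' j' mod int x"
    using diff_class_unique[OF 1(3) 2(2)] 1(1) 2(1) arcs_subset_all assms by blast+
  have "D < x" using 1(2) assms(5) by auto
  then have "D = 0" using shift_mod_cancel[of "shift i j" D 0] eq by auto
  then show False using 1(2) by auto
qed

lemma base_hex_disjoint: "base_hex hex1_arcs \<inter> base_hex hex2_arcs = {}"
proof (rule ccontr)
  assume "\<not> ?thesis"
  then obtain e where "e \<in> base_hex hex1_arcs" "e \<in> base_hex hex2_arcs" by auto
  then obtain i j i' j' where "(i, j) \<in> hex1_arcs" "(i', j') \<in> hex2_arcs"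
    "e \<in> diff_class i j (shift i j)" "e \<in> diff_class i' j' (shift i' j')"
    by (auto simp: base_hex_def)
  then show False using diff_class_unique[of e i j "shift i j" i' j' "shift i' j'"] hex_arcs_subset
    by blast
qed

section \<open>Hamiltonian cycles between two columns\<close>

definition bipath :: "int \<Rightarrow> nat \<times> nat \<Rightarrow> nat \<Rightarrow> nat" where
  "bipath d p k = (if even k then vtx (fst p) (- int (k div 2)) else vtx (snd p) (d - int (k div 2)))"

lemma bipath_eq_iff:
  assumes "bipath d (i, j) k = bipath d (i, j) k'" "i < 6" "j < 6" "i \<noteq> j" "k < 2 * x" "k' < 2 * x"
  shows "k = k'"
proof -
  have par: "even k \<longleftrightarrow> even k'"
    using assms by (auto simp: bipath_def vtx_eq_iff split: if_splits)
  have b: "k div 2 < x" "k' div 2 < x" using assms by auto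
  have "int (k div 2) = int (k' div 2)"
  proof (cases "even k")
    case True
    then have "(- int (k div 2)) mod int x = (- int (k' div 2)) mod int x"
      using assms par by (auto simp: bipath_def vtx_eq_iff)
    from mod_eq_close_imp_eq[OF this] b show ?thesis by simp
  next
    case False
    then have "(d - int (k div 2)) mod int x = (d - int (k' div 2)) mod int x"
      using assms par by (auto simp: bipath_def vtx_eq_iff)
    from mod_eq_close_imp_eq[OF this] b show ?thesis by simp
  qed
  then show ?thesis using par by presburger
qed

lemma bipath_less: "i < 6 \<Longrightarrow> j < 6 \<Longrightarrow> bipath d (i, j) k < 6 * x"
  by (simp add: bipath_def vtx_less)

text \<open>The level falls by one every two steps, so the edges alternate between the differences
  \<open>d\<close> and \<open>d + 1\<close>, and the walk closes after \<open>x\<close>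
  levels.\<close>

lemma cyc_bipath:
  "cyc (2 * x) (bipath d (i, j)) \<subseteq> diff_class i j d \<union> diff_class i j (d + 1)"
proof
  fix e assume "e \<in> cyc (2 * x) (bipath d (i, j))"
  then obtain k where k: "k < 2 * x" "e = {bipath d (i, j) k, bipath d (i, j) (Suc k mod (2 * x))}"
    by (auto simp: cyc_def)
  consider "even k" | "odd k" "Suc k < 2 * x" | "k = 2 * x - 1"
    using k(1) by linarith
  then show "e \<in> diff_class i j d \<union> diff_class i j (d + 1)"
  proof cases
    case 1
    then have "Suc k < 2 * x" using k(1) by presburger
    then have "e = {vtx i (- int (k div 2)), vtx j (d - int (k div 2))}"
      using k 1 by (simp add: bipath_def)
    then show ?thesis using diff_classI(1)[of "d - int (k div 2)" "- int (k div 2)" d i j] by simp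
  next
    case 2
    then have "e = {vtx j (d - int (k div 2)), vtx i (- 1 - int (k div 2))}"
      using k by (simp add: bipath_def)
    then show ?thesis
      using diff_classI(2)[of "d - int (k div 2)" "- 1 - int (k div 2)" "d + 1" j i] by simp
  next
    case 3
    then have "odd k" "k div 2 = x - 1" "Suc k mod (2 * x) = 0" using x_ge by auto
    then have "e = {vtx j (d - (int x - 1)), vtx i 0}"
      using k(2) x_ge by (simp add: bipath_def of_nat_diff)
    moreover have "(d - (int x - 1) - 0) mod int x = (d + 1) mod int x"
      using mod_add_self2[of "d - (int x - 1)" "int x"] by simp
    ultimately show ?thesis using diff_classI(2)[of "d - (int x - 1)" 0 "d + 1" j i] by simp
  qed
qed

lemma cycle_factor_bipath:
  "cycle_factor (2 * x) {..<6 * x} (\<Union>p\<in>arcs q. cyc (2 * x) (bipath (shift (fst p) (snd p) + d) p))"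
proof (rule cycle_factor_UN_cyc)
  show "3 \<le> 2 * x" "finite {..<6 * x}" "card {..<6 * x} = card (arcs q) * (2 * x)"
    using x_ge by (auto simp: card_arcs)
  show "bipath (shift (fst p) (snd p) + d) p k \<in> {..<6 * x}" if "p \<in> arcs q" for p k
    using that arcs_less by (cases p) (auto intro!: bipath_less)
  show "p = p' \<and> k = k'"
    if eq: "bipath (shift (fst p) (snd p) + d) p k = bipath (shift (fst p') (snd p') + d) p' k'"
      and a: "p \<in> arcs q" "p' \<in> arcs q" "k < 2 * x" "k' < 2 * x" for p k p' k'
  proof -
    obtain i j i' j' where p: "p = (i, j)" "p' = (i', j')" by (cases p, cases p')
    note less = arcs_less[OF a(1)[unfolded p]] arcs_less[OF a(2)[unfolded p]]
    have "i = i' \<or> i = j' \<or> j = i' \<or> j = j'"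
      using eq less by (auto simp: p bipath_def vtx_eq_iff split: if_splits)
    from arcs_matching[OF a(1,2)[unfolded p] this] have "p = p'" by (simp add: p)
    moreover from this have "k = k'" using bipath_eq_iff[of _ i j k k'] eq less a(3,4) by (simp add: p)
    ultimately show ?thesis by simp
  qed
qed

lemma UN_cyc_bipath_subset:
  "(\<Union>p\<in>arcs q. cyc (2 * x) (bipath (shift (fst p) (snd p) + (2 * int m + 1)) p)) \<subseteq> base_piece q m"
proof (rule UN_least)
  fix p assume p: "p \<in> arcs q"
  obtain i j where ij: "p = (i, j)" by (cases p)
  have "diff_class i j (shift i j + (2 * int m + 1)) \<union> diff_class i j (shift i j + (2 * int m + 1) + 1)
      \<subseteq> base_piece q m"
    using p ij by (auto simp: base_piece_def algebra_simps)
  then show "cyc (2 * x) (bipath (shift (fst p) (snd p) + (2 * int m + 1)) p) \<subseteq> base_piece q m"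
    using cyc_bipath[of "shift i j + (2 * int m + 1)" i j] unfolding ij fst_conv snd_conv
    by (rule order_trans[rotated])
qed

section \<open>The lift of the first hexagon to 6-cycles\<close>

definition hex1 :: "nat \<Rightarrow> nat \<Rightarrow> nat" where
  "hex1 t i = vtx ([5, 1, 3, 0, 4, 2] ! i) (int t + (if i = 0 then 0 else 2))"

lemma less_6_cases: "(i::nat) < 6 \<Longrightarrow> i = 0 \<or> i = 1 \<or> i = 2 \<or> i = 3 \<or> i = 4 \<or> i = 5"
  by linarith

lemma cycle_factor_hex1: "cycle_factor 6 {..<6 * x} (\<Union>t\<in>{..<x}. cyc 6 (hex1 t))"
proof (rule cycle_factor_UN_cyc)
  show "(3::nat) \<le> 6" "finite {..<6 * x}" "card {..<6 * x} = card {..<x} * 6" by auto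
  have less: "[5, 1, 3, 0, 4, 2 :: nat] ! i < 6" if "i < 6" for i
    using less_6_cases[OF that] by auto
  show "hex1 t i \<in> {..<6 * x}" if "t \<in> {..<x}" "i < 6" for t i
    using less[OF that(2)] unfolding hex1_def lessThan_iff by (rule vtx_less)
  show "t = t' \<and> i = i'" if eq: "hex1 t i = hex1 t' i'"
    and a: "t \<in> {..<x}" "t' \<in> {..<x}" "i < 6" "i' < 6" for t i t' i'
  proof -
    have "distinct [5, 1, 3, 0, 4, 2 :: nat]" by simp
    moreover have "[5, 1, 3, 0, 4, 2 :: nat] ! i = [5, 1, 3, 0, 4, 2] ! i'"
      using eq a less unfolding hex1_def by (simp only: vtx_eq_iff)
    ultimately have i: "i = i'"
      using a nth_eq_iff_index_eq[of "[5, 1, 3, 0, 4, 2 :: nat]" i i'] by simp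
    then have "(int t + (if i = 0 then 0 else 2)) mod int x = (int t' + (if i = 0 then 0 else 2)) mod int x"
      using eq a less unfolding hex1_def i by (simp only: vtx_eq_iff)
    from mod_eq_close_imp_eq[OF this] a i show ?thesis by simp
  qed
qed

text \<open>Leaving column 5 by either of its two arcs raises the level by 2, and the other four
  arcs keep it. Hence the levels \<open>t\<close> in column 5 and \<open>t + 2\<close> elsewhere fit
  all six differences.\<close>

lemma hex1_subset: "(\<Union>t\<in>{..<x}. cyc 6 (hex1 t)) \<subseteq> base_hex hex1_arcs"
proof (rule UN_least, rule subsetI)
  fix t e assume "e \<in> cyc 6 (hex1 t)"
  then obtain i where i: "i < 6" "e = {hex1 t i, hex1 t (Suc i mod 6)}" by (auto simp: cyc_def)
  have I: "{vtx i a, vtx j b} \<in> base_hex hex1_arcs" "{vtx j b, vtx i a} \<in> base_hex hex1_arcs"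
    if "(i, j) \<in> hex1_arcs" "b - a = shift i j" for i j a b
    using that diff_classI(1)[of b a "shift i j" i j] diff_classI(2)[of b a "shift i j" j i]
    by (auto simp: base_hex_def)
  show "e \<in> base_hex hex1_arcs"
    using less_6_cases[OF i(1)]
    by (elim disjE; simp only: i(2) hex1_def, simp) (rule I, simp add: hex1_arcs_def, simp add: shift_def)+
qed

subsection \<open>Walecki cycles in the groups\<close>

text \<open>The \<open>2 * x\<close> points of a group carry the labels 0 to
  \<open>2 * x - 1\<close>. The reduction in \<open>vtx\<close> turns a label \<open>t\<close> of
  the second column into the level \<open>t - x\<close>.\<close>

definition gvtx :: "nat \<times> nat \<Rightarrow> int \<Rightarrow> nat" where
  "gvtx p t = vtx (if t < int x then fst p else snd p) t"

lemma gvtx_eq_imp: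
  assumes "gvtx p t = gvtx p' t'" "p \<in> groups" "p' \<in> groups"
    and "0 \<le> t" "t < 2 * int x" "0 \<le> t'" "t' < 2 * int x"
  shows "p = p' \<and> t = t'"
proof -
  obtain i j i' j' where p: "p = (i, j)" "p' = (i', j')" by (cases p, cases p')
  note less = groups_less[OF assms(2)[unfolded p]] groups_less[OF assms(3)[unfolded p]]
  have "i = i' \<or> i = j' \<or> j = i' \<or> j = j'"
    using assms(1) less by (auto simp: p gvtx_def vtx_eq_iff split: if_splits)
  from groups_matching[OF assms(2,3)[unfolded p] this] have ij: "i = i'" "j = j'" by auto
  have m: "t mod int x = t' mod int x" and c: "t < int x \<longleftrightarrow> t' < int x"
    using assms(1) less by (auto simp: p ij gvtx_def vtx_eq_iff split: if_splits)
  have "\<bar>t - t'\<bar> < int x" using c assms(4-7) by linarith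
  from mod_eq_close_imp_eq[OF m this] show ?thesis by (simp add: p ij)
qed

lemma gvtx_less: "p \<in> groups \<Longrightarrow> gvtx p t < 6 * x"
  using groups_less by (cases p) (auto simp: gvtx_def intro!: vtx_less)

abbreviation (input) w_mod :: int where "w_mod \<equiv> 2 * int x - 1"

text \<open>The vertex \<open>w_mod\<close> is the point at infinity of Walecki's construction over the integers
  modulo \<open>w_mod\<close>. The sums \<open>2k\<close> and \<open>2k + 1\<close> together form the \<open>k\<close>-th Hamiltonian cycle.\<close>

definition w_sum :: "int \<Rightarrow> int \<Rightarrow> int" where
  "w_sum a b = (if a = w_mod then 2 * b else if b = w_mod then 2 * a else a + b) mod w_mod"

definition base_group :: "int set \<Rightarrow> nat set set" where
  "base_group S = {{gvtx p a, gvtx p b} | p a b.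
     p \<in> groups \<and> a \<in> {0..w_mod} \<and> b \<in> {0..w_mod} \<and> w_sum a b \<in> S}"

lemma w_sum_commute: "w_sum a b = w_sum b a"
  by (simp add: w_sum_def add.commute)

text \<open>An edge determines its group and its unordered pair of labels, and \<open>w_sum\<close>
  is symmetric.\<close>

lemma base_group_disjoint:
  assumes "S \<inter> S' = {}"
  shows "base_group S \<inter> base_group S' = {}"
proof (rule ccontr)
  assume "\<not> ?thesis"
  then obtain p a b p' a' b' where
    1: "p \<in> groups" "a \<in> {0..w_mod}" "b \<in> {0..w_mod}" "w_sum a b \<in> S" and
    2: "p' \<in> groups" "a' \<in> {0..w_mod}" "b' \<in> {0..w_mod}" "w_sum a' b' \<in> S'" and
    "{gvtx p a, gvtx p b} = {gvtx p' a', gvtx p' b'}"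
    by (force simp: base_group_def)
  then have "(gvtx p a = gvtx p' a' \<and> gvtx p b = gvtx p' b') \<or>
      (gvtx p a = gvtx p' b' \<and> gvtx p b = gvtx p' a')"
    by (simp only: doubleton_eq_iff)
  then have "(a = a' \<and> b = b') \<or> (a = b' \<and> b = a')"
    using gvtx_eq_imp[of p a p' a'] gvtx_eq_imp[of p b p' b']
      gvtx_eq_imp[of p a p' b'] gvtx_eq_imp[of p b p' a'] 1 2 by auto
  then have "w_sum a b = w_sum a' b'" using w_sum_commute by auto
  then show False using 1 2 assms by auto
qed

lemma base_group_diff_class_disjoint:
  assumes "e \<in> base_group S" "e \<in> diff_class i j d" "(i, j) \<in> all_arcs"
  shows False
proof -
  obtain p a b where p: "p \<in> groups" "e = {gvtx p a, gvtx p b}"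
    using assms(1) by (auto simp: base_group_def)
  obtain g h where gh: "p = (g, h)" by (cases p)
  obtain a' b' where e: "e = {vtx i a', vtx j b'}"
    using assms(2) by (auto simp: diff_class_def)
  note less = groups_less[OF p(1)[unfolded gh]] all_arcs_less(1,2)[OF assms(3)]
  have eq: "{vtx i a', vtx j b'} = {vtx (if a < int x then g else h) a, vtx (if b < int x then g else h) b}"
    using p(2) e by (simp add: gvtx_def gh)
  have "vtx i a' \<in> {vtx (if a < int x then g else h) a, vtx (if b < int x then g else h) b}"
    "vtx j b' \<in> {vtx (if a < int x then g else h) a, vtx (if b < int x then g else h) b}"
    unfolding eq[symmetric] by auto
  then have "i \<in> {g, h} \<and> j \<in> {g, h}"
    using less by (auto simp: vtx_eq_iff split: if_splits)
  then show False using all_arcs_groups[OF assms(3) p(1)[unfolded gh]] by blast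
qed

lemma base_group_piece_disjoint: "base_group S \<inter> base_piece q m = {}"
  using base_group_diff_class_disjoint arcs_subset_all by (fastforce simp: base_piece_def)

lemma base_group_hex_disjoint: "H \<subseteq> all_arcs \<Longrightarrow> base_group S \<inter> base_hex H = {}"
  using base_group_diff_class_disjoint by (fastforce simp: base_hex_def)

text \<open>Walecki's zigzag 0, 1, -1, 2, -2, ...: consecutive terms add up to 1 and 0 in turn, so
  its translate by \<open>k\<close> has only the sums \<open>2k + 1\<close> and
  \<open>2k\<close>.\<close>

definition zig :: "nat \<Rightarrow> int" where
  "zig h = (if even h then - int (h div 2) else int (h div 2) + 1)"

lemma zig_bounds: "h < 2 * x - 1 \<Longrightarrow> \<bar>zig h\<bar> \<le> int x - 1"
  by (auto simp: zig_def elim!: evenE oddE)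

lemma zig_inj: "zig h = zig h' \<Longrightarrow> h = h'"
  unfolding zig_def by (auto split: if_splits elim!: evenE oddE)

lemma zig_add_Suc: "zig h + zig (Suc h) = (if even h then 1 else 0)"
  by (auto simp: zig_def elim!: evenE oddE)

definition walecki :: "nat \<Rightarrow> nat \<times> nat \<Rightarrow> nat \<Rightarrow> nat" where
  "walecki k p i = gvtx p (if i = 0 then w_mod else (int k + zig (i - 1)) mod w_mod)"

lemma cycle_factor_walecki:
  "cycle_factor (2 * x) {..<6 * x} (\<Union>p\<in>groups. cyc (2 * x) (walecki k p))"
proof (rule cycle_factor_UN_cyc)
  show "3 \<le> 2 * x" "finite {..<6 * x}" "card {..<6 * x} = card groups * (2 * x)"
    using x_ge by (auto simp: card_groups)
  show "walecki k p i \<in> {..<6 * x}" if "p \<in> groups" for p i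
    using that by (simp add: walecki_def gvtx_less)
  show "p = p' \<and> i = i'" if eq: "walecki k p i = walecki k p' i'"
    and a: "p \<in> groups" "p' \<in> groups" "i < 2 * x" "i' < 2 * x" for p i p' i'
  proof -
    have pos: "0 < w_mod" using x_ge by simp
    define f where "f i = (if i = 0 then w_mod else (int k + zig (i - 1)) mod w_mod)" for i
    have lt: "y mod w_mod < w_mod" "0 \<le> y mod w_mod" for y using pos by auto
    have f: "0 \<le> f i \<and> f i < 2 * int x" for i
    proof (cases "i = 0")
      case True
      then show ?thesis using pos by (simp add: f_def)
    next
      case False
      then have "f i = (int k + zig (i - 1)) mod w_mod" by (simp add: f_def)
      then show ?thesis using lt[of "int k + zig (i - 1)"] by linarith
    qed
    have pf: "p = p'" "f i = f i'"
      using gvtx_eq_imp[of p "f i" p' "f i'"] eq a f by (auto simp: walecki_def f_def)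
    have "i = 0 \<longleftrightarrow> i' = 0"
      using pf(2) lt(1)[of "int k + zig (i - 1)"] lt(1)[of "int k + zig (i' - 1)"]
      by (auto simp: f_def split: if_splits)
    moreover have "i = i'" if "i \<noteq> 0" "i' \<noteq> 0"
    proof -
      have m: "(int k + zig (i - 1)) mod w_mod = (int k + zig (i' - 1)) mod w_mod"
        using pf(2) that by (simp add: f_def)
      have "i - 1 < 2 * x - 1" "i' - 1 < 2 * x - 1" using a that by auto
      then have "\<bar>(int k + zig (i - 1)) - (int k + zig (i' - 1))\<bar> < w_mod"
        using zig_bounds[of "i - 1"] zig_bounds[of "i' - 1"] by linarith
      from mod_eq_close_imp_eq[OF m this] have "i - 1 = i' - 1" using zig_inj by simp
      then show ?thesis using that by simp
    qed
    ultimately show ?thesis using pf by auto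
  qed
qed

lemma walecki_subset:
  assumes "k < x - 1"
  shows "(\<Union>p\<in>groups. cyc (2 * x) (walecki k p)) \<subseteq> base_group {2 * int k, 2 * int k + 1}"
proof (rule UN_least, rule subsetI)
  fix p e assume p: "p \<in> groups" and "e \<in> cyc (2 * x) (walecki k p)"
  then obtain i where i: "i < 2 * x" "e = {walecki k p i, walecki k p (Suc i mod (2 * x))}"
    by (auto simp: cyc_def)
  have pos: "0 < w_mod" using x_ge by simp
  \<comment> \<open>The bound on \<open>k\<close> gives \<open>2k + 1 <= 2x - 3\<close>, so both
    sums are reduced; the residue \<open>2x - 2\<close> is left for the 1-factor.\<close>
  have k: "(2 * int k) mod w_mod = 2 * int k" "(2 * int k + 1) mod w_mod = 2 * int k + 1"
    using assms by auto
  have I: "{gvtx p a, gvtx p b} \<in> base_group {2 * int k, 2 * int k + 1}"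
    if "a \<in> {0..w_mod}" "b \<in> {0..w_mod}" "w_sum a b \<in> {2 * int k, 2 * int k + 1}" for a b
    using that p unfolding base_group_def by blast
  have lt: "y mod w_mod < w_mod" "0 \<le> y mod w_mod" for y using pos by auto
  have inf: "w_sum w_mod (y mod w_mod) = (2 * y) mod w_mod" for y
    by (simp add: w_sum_def mod_mult_right_eq)
  have fin: "w_sum (y mod w_mod) (z mod w_mod) = (y + z) mod w_mod" for y z
  proof -
    have "y mod w_mod \<noteq> w_mod" "z mod w_mod \<noteq> w_mod"
      using lt(1)[of y] lt(1)[of z] by linarith+
    then show ?thesis by (simp add: w_sum_def mod_add_eq)
  qed
  have range: "y mod w_mod \<in> {0..w_mod}" "w_mod \<in> {0..w_mod}" for y
    using lt[of y] pos unfolding atLeastAtMost_iff by linarith+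
  consider "i = 0" | "i \<noteq> 0" "Suc i < 2 * x" | "i = 2 * x - 1"
    using i(1) by linarith
  then show "e \<in> base_group {2 * int k, 2 * int k + 1}"
  proof cases
    case 1
    then have "e = {gvtx p w_mod, gvtx p (int k mod w_mod)}"
      using i x_ge by (simp add: walecki_def zig_def)
    moreover have "w_sum w_mod (int k mod w_mod) = 2 * int k" using inf k by simp
    ultimately show ?thesis using I range by simp
  next
    case 2
    define h where "h = i - 1"
    have h: "i = Suc h" using 2 by (simp add: h_def)
    have "e = {gvtx p ((int k + zig h) mod w_mod), gvtx p ((int k + zig (Suc h)) mod w_mod)}"
      using i 2 by (simp add: walecki_def h)
    moreover have "(int k + zig h) + (int k + zig (Suc h)) = (if even h then 2 * int k + 1 else 2 * int k)"
      using zig_add_Suc[of h] by auto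
    then have "w_sum ((int k + zig h) mod w_mod) ((int k + zig (Suc h)) mod w_mod) \<in> {2 * int k, 2 * int k + 1}"
      unfolding fin by (simp add: k)
    ultimately show ?thesis using I range by simp
  next
    case 3
    then have "zig (i - 1) = 1 - int x" "Suc i mod (2 * x) = 0" "i \<noteq> 0"
      using x_ge by (auto simp: zig_def)
    then have e: "e = {gvtx p w_mod, gvtx p ((int k + (1 - int x)) mod w_mod)}"
      using i(2) by (simp add: walecki_def insert_commute)
    \<comment> \<open>The closing edge ends at infinity, so the sum is twice the label of its other
      end.\<close>
    have "2 * (int k + (1 - int x)) = 2 * int k + 1 - w_mod" by simp
    then have "(2 * (int k + (1 - int x))) mod w_mod = (2 * int k + 1) mod w_mod"
      by (simp only: minus_mod_self2)
    then have "w_sum w_mod ((int k + (1 - int x)) mod w_mod) = 2 * int k + 1"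
      unfolding inf k .
    then show ?thesis unfolding e using I range by simp
  qed
qed

end

section \<open>Cutting the long cycle\<close>

text \<open>Vertex \<open>2x - 1\<close> lies in column \<open>c\<close> and level \<open>L\<close>. The edges of difference \<open>L\<close> from
  column \<open>0\<close> to column \<open>c\<close> are paired with those of difference \<open>L + s\<close>.\<close>

locale switching = levels +
  fixes c L :: nat and s :: int
  assumes two_x: "2 * x = 6 * L + c + 1"
    and cs: "c = 1 \<and> s = - 1 \<or> c = 3 \<and> s = 1"
begin

text \<open>The second exchange is the translate of the first one by \<open>- s * n\<close> levels. Any \<open>n\<close> keeps the
  bipartite factor a \<open>C\<^bsub>2x\<^esub>\<close>-factor; this one also splits the \<open>6x\<close>-cycle evenly.\<close>

definition n :: nat where "n = (x - 1) div 2"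

text \<open>\<open>sq\<close> and \<open>sm\<close> are the matching and the index of the bipartite factor that takes part
  in the exchange.\<close>

definition sq :: nat where "sq = (if c = 1 then 0 else 1)"

definition sm :: nat where "sm = (L - 1) div 2"

text \<open>Levels are counted such that the exchanges take place at \<open>g = 0\<close> and \<open>g = n\<close>.\<close>

definition pt :: "nat \<Rightarrow> nat \<Rightarrow> nat" where
  "pt i g = vtx i ((if i = 0 then 0 else if i = 5 then - 1 else int L) - s * int g)"

definition swap_out :: "nat set set" where
  "swap_out = (\<Union>g\<in>{0, n}. {{pt 0 g, pt c g}, {pt 5 g, pt (c + 1) g}})"

definition swap_in :: "nat set set" where
  "swap_in = (\<Union>g\<in>{0, n}. {{pt 5 g, pt 0 g}, {pt c g, pt (c + 1) g}})"

lemma n_bounds: "0 < n" "n < x" "x = 2 * n + 1"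
  using x_ge x_odd by (auto simp: n_def elim!: oddE)

lemma c_cases: "c = 1 \<or> c = 3" and s_cases: "s = 1 \<or> s = - 1"
  using cs by auto

lemma pt_eq_iff:
  assumes "i < 6" "j < 6"
  shows "pt i g = pt j h \<longleftrightarrow> i = j \<and> g mod x = h mod x"
proof -
  have K: "(b - s * int g) mod int x = (b - s * int h) mod int x \<longleftrightarrow> g mod x = h mod x" for b
  proof -
    have "(b - s * int g) mod int x = (b - s * int h) mod int x
        \<longleftrightarrow> int x dvd s * (int h - int g)"
      by (simp add: mod_eq_dvd_iff algebra_simps)
    also have "\<dots> \<longleftrightarrow> int x dvd int g - int h"
      using s_cases by (auto simp: dvd_diff_commute)
    also have "\<dots> \<longleftrightarrow> int g mod int x = int h mod int x"
      by (simp add: mod_eq_dvd_iff)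
    also have "\<dots> \<longleftrightarrow> g mod x = h mod x"
      by (simp flip: zmod_int)
    finally show ?thesis .
  qed
  show ?thesis
  proof (cases "i = j")
    case True
    show ?thesis unfolding pt_def True vtx_eq_iff[OF assms(2,2)] K by simp
  next
    case False
    then show ?thesis unfolding pt_def vtx_eq_iff[OF assms] by simp
  qed
qed

lemma pt_add_x: "i < 6 \<Longrightarrow> pt i (g + x) = pt i g"
  by (simp add: pt_eq_iff)

lemma arcs_sq: "arcs sq = {(0, c), (5, c + 1), (if c = 1 then (3, 4) else (1, 2))}"
  using c_cases by (auto simp: arcs_def sq_def)

lemma sq_less: "sq < 4" by (simp add: sq_def)

text \<open>A bipartite factor pairs an odd offset with the next even one. On the arc
  \<open>(0, c)\<close>, where \<open>shift\<close> is 0, the partner of \<open>L\<close> is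
  therefore \<open>L - 1\<close> for \<open>c = 1\<close> and \<open>L + 1\<close> for
  \<open>c = 3\<close>; this is the sign \<open>s\<close>.\<close>

lemma L_parity: "c = 1 \<Longrightarrow> 2 \<le> L \<and> even L" "c = 3 \<Longrightarrow> odd L"
  using two_x x_odd x_ge by presburger+

lemma sm_eq: "2 * int sm + 1 = (if s = 1 then int L else int L - 1)"
proof -
  have "c = 1 \<Longrightarrow> 2 * sm + 2 = L" "c = 3 \<Longrightarrow> 2 * sm + 1 = L"
    using L_parity unfolding sm_def by presburger+
  then show ?thesis using cs by auto
qed

lemma sm_less: "sm < (x - 1) div 2"
proof -
  have "L \<le> x - 2" using two_x x_ge c_cases by auto
  then show ?thesis using n_bounds(3) x_ge c_cases two_x L_parity unfolding sm_def by auto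
qed

text \<open>Measured from \<open>shift\<close> (2 on \<open>(5, 2)\<close>, 0 on
  \<open>(5, 4)\<close>), the chord difference \<open>L + 1\<close> takes the offset of the pair
  that \<open>L\<close> does not take, so its partner is reached by \<open>- s\<close> instead of
  \<open>s\<close>. Hence the two bipartite cycles run in opposite directions.\<close>

lemma diff_class_subset_piece:
  "diff_class 0 c (int L) \<subseteq> base_piece sq sm"
  "diff_class 0 c (int L + s) \<subseteq> base_piece sq sm"
  "diff_class 5 (c + 1) (int L + 1) \<subseteq> base_piece sq sm"
  "diff_class 5 (c + 1) (int L + 1 - s) \<subseteq> base_piece sq sm"
proof -
  have sub: "diff_class i j d \<subseteq> base_piece sq sm"
    if "(i, j) \<in> arcs sq" "d = shift i j + (2 * int sm + 1) \<or> d = shift i j + (2 * int sm + 1) + 1"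
    for i j d
    using that by (auto simp: base_piece_def algebra_simps)
  have arcs: "(0, c) \<in> arcs sq" "(5, c + 1) \<in> arcs sq" by (auto simp: arcs_sq)
  show "diff_class 0 c (int L) \<subseteq> base_piece sq sm"
    "diff_class 0 c (int L + s) \<subseteq> base_piece sq sm"
    by (rule sub[OF arcs(1)]; use cs in \<open>auto simp: sm_eq shift_def\<close>)+
  show "diff_class 5 (c + 1) (int L + 1) \<subseteq> base_piece sq sm"
    "diff_class 5 (c + 1) (int L + 1 - s) \<subseteq> base_piece sq sm"
    by (rule sub[OF arcs(2)]; use cs in \<open>auto simp: sm_eq shift_def\<close>)+
qed

lemma pt_edge_in_piece:
  "{pt 0 g, pt c g} \<in> base_piece sq sm"
  "{pt 0 (Suc g), pt c g} \<in> base_piece sq sm"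
  "{pt 5 g, pt (c + 1) g} \<in> base_piece sq sm"
  "{pt 5 g, pt (c + 1) (Suc g)} \<in> base_piece sq sm"
proof -
  have c: "c \<noteq> 0" "c \<noteq> 5" "c + 1 \<noteq> 0" "c + 1 \<noteq> 5" using c_cases by auto
  have "{pt 0 g, pt c g} \<in> diff_class 0 c (int L)"
    "{pt 0 (Suc g), pt c g} \<in> diff_class 0 c (int L + s)"
    "{pt 5 g, pt (c + 1) g} \<in> diff_class 5 (c + 1) (int L + 1)"
    "{pt 5 g, pt (c + 1) (Suc g)} \<in> diff_class 5 (c + 1) (int L + 1 - s)"
    unfolding pt_def using c
    by (simp_all only: if_True if_False simp_thms) (rule diff_classI(1), simp add: algebra_simps)+
  then show "{pt 0 g, pt c g} \<in> base_piece sq sm"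
    "{pt 0 (Suc g), pt c g} \<in> base_piece sq sm"
    "{pt 5 g, pt (c + 1) g} \<in> base_piece sq sm"
    "{pt 5 g, pt (c + 1) (Suc g)} \<in> base_piece sq sm"
    using diff_class_subset_piece by blast+
qed

lemma swap_out_subset: "swap_out \<subseteq> base_piece sq sm"
  using pt_edge_in_piece by (auto simp: swap_out_def)

lemma swap_in_subset: "swap_in \<subseteq> base_hex hex2_arcs"
proof -
  have sub: "diff_class i j (shift i j) \<subseteq> base_hex hex2_arcs" if "(i, j) \<in> hex2_arcs" for i j
    using that by (auto simp: base_hex_def)
  have "{pt 5 g, pt 0 g} \<in> diff_class 5 0 1" for g
    unfolding pt_def by (simp, rule diff_classI(1)) simp
  moreover have "{pt c g, pt (c + 1) g} \<in> diff_class c (c + 1) 0" for g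
    unfolding pt_def using c_cases by (auto intro!: diff_classI(1))
  moreover have "diff_class 5 0 1 \<subseteq> base_hex hex2_arcs"
    using sub[of 5 0] by (simp add: hex2_arcs_def shift_def)
  moreover have "diff_class c (c + 1) 0 \<subseteq> base_hex hex2_arcs"
    using sub[of c "c + 1"] c_cases by (auto simp: hex2_arcs_def shift_def)
  ultimately show ?thesis unfolding swap_in_def by blast
qed

lemma swap_outD:
  assumes "{pt i g, pt j h} \<in> swap_out" "i < 6" "j < 6"
  shows "g mod x = h mod x \<and> (g mod x = 0 \<or> g mod x = n)"
proof -
  have c: "c < 6" "c + 1 < 6" using c_cases by auto
  obtain k where k: "k = 0 \<or> k = n"
    "{pt i g, pt j h} = {pt 0 k, pt c k} \<or> {pt i g, pt j h} = {pt 5 k, pt (c + 1) k}"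
    using assms(1) by (auto simp: swap_out_def)
  then have "g mod x = k mod x \<and> h mod x = k mod x"
    using assms(2,3) c by (auto simp: doubleton_eq_iff pt_eq_iff)
  then show ?thesis using k(1) n_bounds by auto
qed

section \<open>The switched cycles of the bipartite factor\<close>

definition zcyc :: "nat \<Rightarrow> nat \<Rightarrow> nat \<Rightarrow> nat" where
  "zcyc k m i =
     (if i < 2 * m then (if even i then pt c (k + i div 2) else pt 0 (k + i div 2 + 1))
      else (if even i then pt 5 (k + i div 2) else pt (c + 1) (k + i div 2 + 1)))"

lemma mod_eq_close_nat:
  assumes "(a::nat) mod x = b mod x" "a < b + x" "b < a + x"
  shows "a = b"
proof -
  have "int a mod int x = int b mod int x" using assms(1) by (simp flip: zmod_int)
  from mod_eq_close_imp_eq[OF this] assms(2,3) show ?thesis by simp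
qed

text \<open>A cycle takes \<open>m\<close> levels of columns \<open>c\<close> and \<open>0\<close>,
  then \<open>x - m\<close> levels of columns \<open>5\<close> and \<open>c + 1\<close>. With
  \<open>h = i div 2\<close>, over both cycles \<open>k + h\<close> covers 0 to \<open>x - 1\<close>
  in the first part and \<open>n\<close> to \<open>n + x - 1\<close> in the second, each value of
  \<open>k + h\<close> coming from only one of the two cycles.\<close>

lemma zcyc_eq_imp:
  assumes eq: "zcyc k m i = zcyc k' m' i'" and i: "i < 2 * x" "i' < 2 * x"
    and km: "k = 0 \<and> m = n \<or> k = n \<and> m = x - n" "k' = 0 \<and> m' = n \<or> k' = n \<and> m' = x - n"
  shows "k = k' \<and> i = i'"
proof -
  have c: "c < 6" "c + 1 < 6" "c \<noteq> 0" "c \<noteq> 5" "c + 1 \<noteq> 5" using c_cases by auto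
  define h h' where "h = i div 2" and "h' = i' div 2"
  have h: "h < x" "h' < x" "i < 2 * m \<longleftrightarrow> h < m" "i' < 2 * m' \<longleftrightarrow> h' < m'"
    using i by (auto simp: h_def h'_def)
  have par: "even i \<longleftrightarrow> even i'" and side: "h < m \<longleftrightarrow> h' < m'"
    using eq c unfolding zcyc_def h(3,4)[symmetric] by (auto simp: pt_eq_iff split: if_splits)
  have "(k + h) mod x = (k' + h') mod x \<or> (k + h + 1) mod x = (k' + h' + 1) mod x"
    using eq c unfolding zcyc_def h_def[symmetric] h'_def[symmetric]
    by (auto simp: pt_eq_iff split: if_splits)
  moreover have "k + h < k' + h' + x" "k' + h' < k + h + x"
    using h(1,2) side km n_bounds by auto
  ultimately have "k + h = k' + h'"
    using mod_eq_close_nat[of "k + h" "k' + h'"] mod_eq_close_nat[of "k + h + 1" "k' + h' + 1"] by auto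
  moreover from this have "k = k'" using h(1,2) side km n_bounds by auto
  ultimately have "k = k'" "h = h'" by auto
  then show ?thesis using par unfolding h_def h'_def by presburger
qed

lemma mod_between:
  assumes "0 < g" "g < 2 * x" "g \<noteq> x" "g \<noteq> n" "g \<noteq> n + x"
  shows "\<not> (g mod x = 0 \<or> g mod x = n)"
proof (cases "g < x")
  case False
  then have "g mod x = g - x" using assms by (simp add: mod_if)
  then show ?thesis using assms False by auto
qed (use assms in auto)

lemma cyc_zcyc:
  assumes km: "k = 0 \<and> m = n \<or> k = n \<and> m = x - n"
  shows "cyc (2 * x) (zcyc k m) \<subseteq> (base_piece sq sm - swap_out) \<union> swap_in"
proof
  fix e assume "e \<in> cyc (2 * x) (zcyc k m)"
  then obtain i where i: "i < 2 * x" "e = {zcyc k m i, zcyc k m (Suc i mod (2 * x))}"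
    by (auto simp: cyc_def)
  have c: "c < 6" "c + 1 < 6" "0 < (6::nat)" "5 < (6::nat)" using c_cases by auto
  define h where "h = i div 2"
  have hx: "h < x" using i by (simp add: h_def)
  have m: "0 < m" "m < x" using km n_bounds by auto
  have SucD: "g mod x \<noteq> Suc g mod x" for g
    using mod_eq_close_nat[of g "Suc g"] x_ge by auto
  have km': "k + m = n \<or> k + m = x" using km n_bounds by auto
  \<comment> \<open>Cases 1 and 4 join different values of \<open>g\<close>, cases 2 and 5 equal
    ones away from the exchange values 0 and \<open>n\<close>, so none is in
    \<open>swap_out\<close>. Cases 3 and 6 are the transitions between the two parts and lie in
    \<open>swap_in\<close>.\<close>
  consider "even i" "i < 2 * m" | "odd i" "Suc i < 2 * m" | "Suc i = 2 * m"
    | "even i" "2 * m \<le> i" | "odd i" "2 * m \<le> i" "Suc i < 2 * x" | "Suc i = 2 * x"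
    using i(1) by linarith
  then show "e \<in> (base_piece sq sm - swap_out) \<union> swap_in"
  proof cases
    case 1
    then have "Suc i < 2 * m" "Suc i < 2 * x" using m by presburger+
    then have e: "e = {pt 0 (Suc (k + h)), pt c (k + h)}"
      using 1 i(2) by (auto simp: zcyc_def h_def)
    then have "e \<notin> swap_out" using swap_outD[of 0 "Suc (k + h)" c "k + h"] c SucD by metis
    then show ?thesis using e pt_edge_in_piece by auto
  next
    case 2
    then have e: "e = {pt 0 (k + h + 1), pt c (k + h + 1)}"
      using i(2) m by (simp add: zcyc_def h_def)
    have "h + 1 < m" using 2 by (auto simp: h_def elim!: oddE)
    then have "\<not> ((k + h + 1) mod x = 0 \<or> (k + h + 1) mod x = n)"
      using km n_bounds by (intro mod_between) auto
    then have "e \<notin> swap_out" using e swap_outD[of 0 "k + h + 1" c "k + h + 1"] c by blast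
    then show ?thesis using e pt_edge_in_piece by auto
  next
    case 3
    then have "odd i" "i < 2 * m" "h + 1 = m" "Suc i < 2 * x" using m by (presburger | simp add: h_def)+
    then have e: "e = {pt 5 (k + m), pt 0 (k + m)}"
      using i(2) 3 by (auto simp: zcyc_def h_def)
    have "e = {pt 5 n, pt 0 n} \<or> e = {pt 5 0, pt 0 0}"
      using km' e pt_add_x[of 5 0] pt_add_x[of 0 0] by auto
    then show ?thesis by (auto simp: swap_in_def)
  next
    case 4
    then have "Suc i < 2 * x" using i by presburger
    then have e: "e = {pt 5 (k + h), pt (c + 1) (Suc (k + h))}"
      using 4 i(2) by (auto simp: zcyc_def h_def)
    then have "e \<notin> swap_out" using swap_outD[of 5 "k + h" "c + 1" "Suc (k + h)"] c SucD by metis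
    then show ?thesis using e pt_edge_in_piece by auto
  next
    case 5
    then have e: "e = {pt 5 (k + h + 1), pt (c + 1) (k + h + 1)}"
      using i(2) by (auto simp: zcyc_def h_def)
    have "h + 1 < x" "m \<le> h" using 5 by (auto simp: h_def elim!: oddE)
    then have "\<not> ((k + h + 1) mod x = 0 \<or> (k + h + 1) mod x = n)"
      using km n_bounds by (intro mod_between) auto
    then have "e \<notin> swap_out" using e swap_outD[of 5 "k + h + 1" "c + 1" "k + h + 1"] c by blast
    then show ?thesis using e pt_edge_in_piece by auto
  next
    case 6
    then have "odd i" "2 * m \<le> i" "h + 1 = x" "Suc i mod (2 * x) = 0"
      using m by (presburger | simp add: h_def)+
    then have "e = {pt c k, pt (c + 1) (k + x)}"
      using i(2) m by (auto simp: zcyc_def h_def)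
    then have "e = {pt c k, pt (c + 1) k}" using pt_add_x c by simp
    then show ?thesis using km by (auto simp: swap_in_def)
  qed
qed

text \<open>Both switched cycles visit four columns; the arcs \<open>(0, c)\<close> and
  \<open>(5, c + 1)\<close> serve only to index them.\<close>

definition switched_piece :: "nat \<times> nat \<Rightarrow> nat \<Rightarrow> nat" where
  "switched_piece p = (if p = (0, c) then zcyc 0 n else if p = (5, c + 1) then zcyc n (x - n)
     else bipath (shift (fst p) (snd p) + (2 * int sm + 1)) p)"


lemma switched_piece_cases:
  assumes "p \<in> arcs sq"
  obtains "p = (0, c)" "switched_piece p = zcyc 0 n"
  | "p = (5, c + 1)" "switched_piece p = zcyc n (x - n)"
  | i j where "p = (i, j)" "i < 6" "j < 6" "i \<noteq> j" "{i, j} \<inter> {0, c, 5, c + 1} = {}"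
      "switched_piece p = bipath (shift i j + (2 * int sm + 1)) p"
  using assms c_cases that unfolding arcs_sq
  by (auto simp: switched_piece_def split: if_splits)

lemma zcyc_col: "\<exists>i g. i \<in> {0, c, 5, c + 1} \<and> zcyc k m l = pt i g"
  unfolding zcyc_def by auto

lemma zcyc_bipath_neq:
  assumes "i < 6" "j < 6" "{i, j} \<inter> {0, c, 5, c + 1} = {}"
  shows "zcyc k m l \<noteq> bipath d (i, j) l'"
proof -
  obtain i' g where i': "i' \<in> {0, c, 5, c + 1}" "zcyc k m l = pt i' g" using zcyc_col by blast
  moreover have "i' < 6" using i' c_cases by auto
  ultimately show ?thesis using assms by (auto simp: bipath_def pt_def vtx_eq_iff)
qed

lemma cycle_factor_switched_piece: "cycle_factor (2 * x) {..<6 * x} (\<Union>p\<in>arcs sq. cyc (2 * x) (switched_piece p))"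
proof (rule cycle_factor_UN_cyc)
  show "3 \<le> 2 * x" "finite {..<6 * x}" "card {..<6 * x} = card (arcs sq) * (2 * x)"
    using x_ge by (auto simp: card_arcs)
  have zl: "zcyc k m l < 6 * x" for k m l
    using c_cases by (auto simp: zcyc_def pt_def intro!: vtx_less)
  show "switched_piece p l \<in> {..<6 * x}" if "p \<in> arcs sq" for p l
    using that by (rule switched_piece_cases) (auto simp: zl bipath_less)
  show "p = p' \<and> l = l'" if eq: "switched_piece p l = switched_piece p' l'"
    and a: "p \<in> arcs sq" "p' \<in> arcs sq" "l < 2 * x" "l' < 2 * x" for p l p' l'
    using a(1)
  proof (cases rule: switched_piece_cases)
    case 1
    note 1 = this
    from a(2) show ?thesis
    proof (cases rule: switched_piece_cases)
      case 1
      then show ?thesis using \<open>p = _\<close> eq zcyc_eq_imp[of 0 n l 0 n l'] a by simp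
    next
      case 2
      then show ?thesis using 1 eq zcyc_eq_imp[of 0 n l n "x - n" l'] a n_bounds(1) by simp
    next
      case (3 i j)
      then show ?thesis using 1 eq zcyc_bipath_neq[of i j 0 n l _ l'] by simp
    qed
  next
    case 2
    note 2 = this
    from a(2) show ?thesis
    proof (cases rule: switched_piece_cases)
      case 1
      then show ?thesis using 2 eq zcyc_eq_imp[of n "x - n" l 0 n l'] a n_bounds(1) by simp
    next
      case 2
      then show ?thesis using \<open>p = _\<close> eq zcyc_eq_imp[of n "x - n" l n "x - n" l'] a by simp
    next
      case (3 i j)
      then show ?thesis using 2 eq zcyc_bipath_neq[of i j n "x - n" l _ l'] by simp
    qed
  next
    case (3 i j)
    note 3 = this
    from a(2) show ?thesis
    proof (cases rule: switched_piece_cases)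
      case 1
      then show ?thesis using 3 eq zcyc_bipath_neq[of i j 0 n l' _ l, symmetric] by simp
    next
      case 2
      then show ?thesis using 3 eq zcyc_bipath_neq[of i j n "x - n" l' _ l, symmetric] by simp
    next
      case (3 i' j')
      then have "p' = p" using a(1,2) \<open>p = (i, j)\<close> \<open>{i, j} \<inter> _ = _\<close> by (auto simp: arcs_sq split: if_splits)
      moreover from this have "l = l'" using 3 eq a \<open>p = (i, j)\<close> bipath_eq_iff[of _ i j l l'] by simp
      ultimately show ?thesis by simp
    qed
  qed
qed

lemma switched_piece_subset:
  "(\<Union>p\<in>arcs sq. cyc (2 * x) (switched_piece p)) \<subseteq> (base_piece sq sm - swap_out) \<union> swap_in"
proof (rule UN_least)
  fix p assume p: "p \<in> arcs sq"
  then show "cyc (2 * x) (switched_piece p) \<subseteq> (base_piece sq sm - swap_out) \<union> swap_in"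
  proof (cases rule: switched_piece_cases)
    case 1
    then show ?thesis using cyc_zcyc by simp
  next
    case 2
    then show ?thesis using cyc_zcyc by simp
  next
    case (3 i j)
    have "cyc (2 * x) (switched_piece p) \<subseteq> base_piece sq sm"
    proof -
      have "switched_piece p = bipath (shift (fst p) (snd p) + (2 * int sm + 1)) p"
        using 3 by simp
      then show ?thesis using UN_cyc_bipath_subset p by fastforce
    qed
    moreover have "e \<notin> swap_out" if e: "e \<in> cyc (2 * x) (switched_piece p)" for e
    proof
      assume "e \<in> swap_out"
      then obtain k g where k: "k \<in> {0, c, 5, c + 1}" "pt k g \<in> e"
        by (auto simp: swap_out_def)
      have "k < 6" using k(1) c_cases by auto
      obtain l where "pt k g = bipath (shift i j + (2 * int sm + 1)) (i, j) l"
        using e k(2) 3 by (auto simp: cyc_def)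
      then show False using 3 k \<open>k < 6\<close> by (auto simp: bipath_def pt_def vtx_eq_iff split: if_splits)
    qed
    ultimately show ?thesis by blast
  qed
qed

section \<open>The three pieces of the long cycle\<close>

definition rho :: nat where "rho = (if s = 1 then x - n else n)"

text \<open>\<open>rho\<close> is the residue of \<open>- s * n\<close>, the level of
  \<open>pt 0 n\<close>, and equals \<open>n\<close> or \<open>n + 1\<close>. The bounds place the
  segment from \<open>6 * rho\<close> to \<open>6 * rho + 2 * x - 1\<close> inside the
  \<open>4 * x\<close> vertices left by the first exchange.\<close>

lemma rho_bounds: "2 * x \<le> 6 * rho" "6 * rho + 2 * x < 6 * x" "rho < x" "0 < rho" "L + rho < x"
  using n_bounds x_ge two_x c_cases by (auto simp: rho_def)

lemma vtx_minus_1: "0 < a \<Longrightarrow> a < x \<Longrightarrow> vtx 5 (int a - 1) = 6 * a - 1"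
  using vtx_of_nat[of "a - 1" 5] by (simp add: of_nat_diff)

lemma pt_0: "pt 0 0 = 0" "pt 5 0 = 6 * x - 1" "pt c 0 = 2 * x - 1" "pt (c + 1) 0 = 2 * x"
proof -
  have c: "c \<noteq> 0" "c \<noteq> 5" "c + 1 \<noteq> 5" using c_cases by auto
  have "L < x" using rho_bounds by simp
  then show "pt c 0 = 2 * x - 1" "pt (c + 1) 0 = 2 * x"
    using c two_x by (simp_all add: pt_def vtx_of_nat)
  show "pt 0 0 = 0" by (simp add: pt_def vtx_def)
  have "(- 1) mod int x = int x - 1" using x_ge by (simp add: zmod_minus1)
  then show "pt 5 0 = 6 * x - 1" using x_ge by (simp add: pt_def vtx_def nat_diff_distrib)
qed

text \<open>Translation by \<open>rho\<close> levels adds \<open>6 * rho\<close>, and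
  \<open>L + rho < x\<close> excludes a wrap-around. Column 5 starts at level -1, hence
  \<open>6 * rho - 1\<close>.\<close>

lemma pt_n: "pt 0 n = 6 * rho" "pt 5 n = 6 * rho - 1" "pt c n = 6 * rho + 2 * x - 1"
  "pt (c + 1) n = 6 * rho + 2 * x"
proof -
  have c: "c \<noteq> 0" "c \<noteq> 5" "c + 1 \<noteq> 5" using c_cases by auto
  have "(b - s * int n) mod int x = (b + int rho) mod int x" for b
  proof (cases "s = 1")
    case True
    have "rho + n = x" using True n_bounds(2) unfolding rho_def by simp
    moreover have "s * int n = int n" using True by simp
    ultimately have "b - s * int n = b + int rho - int x" by linarith
    then show ?thesis by (simp only: minus_mod_self2)
  next
    case False
    then have "rho = n" unfolding rho_def by simp
    moreover have "s * int n = - int n" using False s_cases by auto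
    ultimately show ?thesis by simp
  qed
  then have shift: "vtx i (b - s * int n) = vtx i (b + int rho)" for i b
    by (simp only: vtx_def)
  show "pt 0 n = 6 * rho"
    unfolding pt_def shift using rho_bounds vtx_of_nat[of rho 0] by simp
  show "pt 5 n = 6 * rho - 1"
    unfolding pt_def shift using rho_bounds vtx_minus_1[of rho] by simp
  show "pt c n = 6 * rho + 2 * x - 1" "pt (c + 1) n = 6 * rho + 2 * x"
    unfolding pt_def shift using c rho_bounds two_x vtx_of_nat[of "L + rho" c] vtx_of_nat[of "L + rho" "c + 1"]
    by simp_all
qed

lemma swap_in_eq: "swap_in = {{6 * x - 1, 0}, {2 * x - 1, 2 * x}, {6 * rho - 1, 6 * rho},
    {6 * rho + 2 * x - 1, 6 * rho + 2 * x}}"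
  by (simp only: swap_in_def pt_0 pt_n UN_insert UN_empty) (simp add: insert_commute)

lemma swap_out_eq: "swap_out = {{0, 2 * x - 1}, {6 * x - 1, 2 * x}, {6 * rho, 6 * rho + 2 * x - 1},
    {6 * rho - 1, 6 * rho + 2 * x}}"
  by (simp only: swap_out_def pt_0 pt_n UN_insert UN_empty) (simp add: insert_commute)

text \<open>Along consecutive numbers the level changes only from column 5 to column 0, where
  \<open>shift\<close> is 1; the step from column 4 to 5 uses the arc \<open>(5, 4)\<close>
  backwards.\<close>

lemma Suc_edge_in_hex2:
  assumes "Suc p < 6 * x"
  shows "{p, Suc p} \<in> base_hex hex2_arcs"
proof -
  define a i where "a = p div 6" and "i = p mod 6"
  have p: "p = 6 * a + i" "i < 6" by (auto simp: a_def i_def)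
  have a: "a < x" using assms p by simp
  have I: "{vtx i a, vtx j b} \<in> base_hex hex2_arcs" "{vtx j b, vtx i a} \<in> base_hex hex2_arcs"
    if "(i, j) \<in> hex2_arcs" "b - a = shift i j" for i j a b
    using that diff_classI(1)[of b a "shift i j" i j] diff_classI(2)[of b a "shift i j" j i]
    by (auto simp: base_hex_def)
  consider "i < 4" | "i = 4" | "i = 5" using p(2) by linarith
  then show ?thesis
  proof cases
    case 1
    then have "(i, i + 1) \<in> hex2_arcs" "shift i (i + 1) = 0"
      using less_6_cases[OF p(2)] by (auto simp: hex2_arcs_def shift_def)
    from I(1)[of i "i + 1" "int a" "int a"] this show ?thesis
      using a by (simp add: vtx_of_nat p)
  next
    case 2
    have "{vtx 4 (int a), vtx 5 (int a)} \<in> base_hex hex2_arcs"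
      using I(2)[of 5 4 "int a" "int a"] by (simp add: hex2_arcs_def shift_def)
    moreover have "vtx 4 (int a) = p" "vtx 5 (int a) = Suc p" using a 2 p by (auto simp: vtx_of_nat)
    ultimately show ?thesis by simp
  next
    case 3
    then have "Suc a < x" using assms p by simp
    from I(1)[of 5 0 "int (Suc a)" "int a"] this show ?thesis
      using a 3 vtx_of_nat[of "Suc a" 0] by (simp add: vtx_of_nat p hex2_arcs_def shift_def)
  qed
qed

text \<open>The third cycle runs from \<open>2 * x\<close> to \<open>6 * rho - 1\<close> and then
  from \<open>6 * rho + 2 * x\<close> to \<open>6 * x - 1\<close>; the offset \<open>4 * x\<close>
  skips the \<open>2 * x\<close> vertices of the second cycle.\<close>

definition cut_hex2 :: "nat \<Rightarrow> nat \<Rightarrow> nat" where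
  "cut_hex2 t i = (if t = 0 then i else if t = 1 then 6 * rho + i
     else if i < 6 * rho - 2 * x then 2 * x + i else 4 * x + i)"

lemma cycle_factor_cut_hex2: "cycle_factor (2 * x) {..<6 * x} (\<Union>t\<in>{0, 1, 2}. cyc (2 * x) (cut_hex2 t))"
proof (rule cycle_factor_UN_cyc)
  show "3 \<le> 2 * x" "finite {..<6 * x}" "card {..<6 * x} = card {0, 1, 2::nat} * (2 * x)"
    using x_ge by auto
  show "cut_hex2 t i \<in> {..<6 * x}" if "t \<in> {0, 1, 2}" "i < 2 * x" for t i
    using that rho_bounds by (auto simp: cut_hex2_def)
  show "t = t' \<and> i = i'" if "cut_hex2 t i = cut_hex2 t' i'" "t \<in> {0, 1, 2}" "t' \<in> {0, 1, 2}"
    "i < 2 * x" "i' < 2 * x" for t i t' i'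
    using that rho_bounds by (auto simp: cut_hex2_def split: if_splits)
qed

lemma cut_hex2_subset:
  "(\<Union>t\<in>{0, 1, 2}. cyc (2 * x) (cut_hex2 t)) \<subseteq> (base_hex hex2_arcs - swap_in) \<union> swap_out"
proof (rule UN_least, rule subsetI)
  fix t e assume t: "t \<in> {0, 1, 2::nat}" and "e \<in> cyc (2 * x) (cut_hex2 t)"
  then obtain i where i: "i < 2 * x" "e = {cut_hex2 t i, cut_hex2 t (Suc i mod (2 * x))}"
    by (auto simp: cyc_def)
  have step: "{p, Suc p} \<in> base_hex hex2_arcs - swap_in"
    if "Suc p < 6 * x" "Suc p \<noteq> 2 * x" "Suc p \<noteq> 6 * rho" "Suc p \<noteq> 6 * rho + 2 * x" for p
    using Suc_edge_in_hex2[OF that(1)] that rho_bounds x_ge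
    by (auto simp: swap_in_eq doubleton_eq_iff)
  have "Suc i = 2 * x \<or> Suc i < 2 * x" using i by auto
  then show "e \<in> (base_hex hex2_arcs - swap_in) \<union> swap_out"
  proof
    assume l: "Suc i = 2 * x"
    then have "e = {cut_hex2 t (2 * x - 1), cut_hex2 t 0}" using i(2) by (metis diff_Suc_1 mod_self)
    \<comment> \<open>Both segments of the third cycle are nonempty, so it closes with the chord
      from \<open>6 * x - 1\<close> to \<open>2 * x\<close>.\<close>
    moreover have "0 < 6 * rho - 2 * x" "\<not> 2 * x - 1 < 6 * rho - 2 * x"
      using rho_bounds n_bounds two_x c_cases x_ge by (auto simp: rho_def)
    ultimately have "e \<in> swap_out"
      using t x_ge by (auto simp: cut_hex2_def swap_out_eq insert_commute)
    then show ?thesis by simp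
  next
    assume l: "Suc i < 2 * x"
    then have e: "e = {cut_hex2 t i, cut_hex2 t (Suc i)}" using i by simp
    show ?thesis
    proof (cases "t = 2 \<and> Suc i = 6 * rho - 2 * x")
      case True
      then have "e = {6 * rho - 1, 6 * rho + 2 * x}"
        using e rho_bounds by (auto simp: cut_hex2_def)
      then show ?thesis by (simp add: swap_out_eq)
    next
      case False
      then have "cut_hex2 t (Suc i) = Suc (cut_hex2 t i)" using t by (auto simp: cut_hex2_def)
      moreover have "{cut_hex2 t i, Suc (cut_hex2 t i)} \<in> base_hex hex2_arcs - swap_in"
        using False t l rho_bounds by (intro step) (auto simp: cut_hex2_def)
      ultimately show ?thesis using e by simp
    qed
  qed
qed

subsection \<open>The disjoint factors\<close>

text \<open>The edges allotted to each factor before the exchange; only \<open>(0, 0)\<close> and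
  \<open>(sq + 2, sm)\<close> trade edges afterwards.\<close>

definition base :: "nat \<times> nat \<Rightarrow> nat set set" where
  "base z = (case z of (l, m) \<Rightarrow>
     if l = 0 then base_hex hex2_arcs
     else if l = 1 then base_group {2 * int m, 2 * int m + 1}
     else base_piece (l - 2) m)"

definition factor :: "nat \<times> nat \<Rightarrow> nat set set" where
  "factor z = (case z of (l, m) \<Rightarrow>
     if l = 0 then \<Union>t\<in>{0, 1, 2}. cyc (2 * x) (cut_hex2 t)
     else if l = 1 then \<Union>p\<in>groups. cyc (2 * x) (walecki m p)
     else if l = sq + 2 \<and> m = sm then \<Union>p\<in>arcs sq. cyc (2 * x) (switched_piece p)
     else \<Union>p\<in>arcs (l - 2). cyc (2 * x) (bipath (shift (fst p) (snd p) + (2 * int m + 1)) p))"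

definition index :: "(nat \<times> nat) set" where
  "index = insert (0, 0) ({1} \<times> {..<x - 1} \<union> {2..<6} \<times> {..<(x - 1) div 2})"

lemma card_index: "finite index" "card index = 3 * x - 2"
proof -
  show "finite index" by (simp add: index_def)
  have "card ({1::nat} \<times> {..<x - 1} \<union> {2..<6} \<times> {..<(x - 1) div 2})
      = (x - 1) + 4 * ((x - 1) div 2)"
    by (subst card_Un_disjoint) (auto simp: card_cartesian_product)
  then have "card index = x + 4 * n"
    using x_ge by (simp add: index_def n_def)
  then show "card index = 3 * x - 2"
    using n_bounds(3) by linarith
qed

lemma base_disjoint:
  assumes "z \<in> index" "z' \<in> index" "e \<in> base z" "e \<in> base z'"
  shows "z = z'"
proof -
  obtain l m l' m' where z: "z = (l, m)" "z' = (l', m')" by (cases z, cases z')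
  have a: "l = 0 \<and> m = 0 \<or> l = 1 \<or> 2 \<le> l \<and> l - 2 < 4 \<and> m < (x - 1) div 2"
    "l' = 0 \<and> m' = 0 \<or> l' = 1 \<or> 2 \<le> l' \<and> l' - 2 < 4 \<and> m' < (x - 1) div 2"
    using assms(1,2) by (auto simp: index_def z)
  have e: "l = 0 \<Longrightarrow> e \<in> base_hex hex2_arcs" "l = 1 \<Longrightarrow> e \<in> base_group {2 * int m, 2 * int m + 1}"
    "2 \<le> l \<Longrightarrow> e \<in> base_piece (l - 2) m"
    using assms(3) by (auto simp: base_def z split: if_splits)
  have e': "l' = 0 \<Longrightarrow> e \<in> base_hex hex2_arcs"
    "l' = 1 \<Longrightarrow> e \<in> base_group {2 * int m', 2 * int m' + 1}"
    "2 \<le> l' \<Longrightarrow> e \<in> base_piece (l' - 2) m'"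
    using assms(4) by (auto simp: base_def z split: if_splits)
  have grp: "m = m'" if "l = 1" "l' = 1"
  proof (rule ccontr)
    assume "m \<noteq> m'"
    then have "{2 * int m, 2 * int m + 1} \<inter> {2 * int m', 2 * int m' + 1} = {}" by auto
    from base_group_disjoint[OF this] e(2) e'(2) that show False by auto
  qed
  have pie: "l = l' \<and> m = m'" if "2 \<le> l" "2 \<le> l'"
    using base_piece_disjoint[of e "l - 2" m "l' - 2" m'] e(3) e'(3) a that by auto
  from a show ?thesis
    using e e' grp pie base_group_hex_disjoint[OF hex_arcs_subset(2)] base_group_piece_disjoint
      base_piece_hex_disjoint[OF _ _ hex_arcs_subset(2)]
    by (elim disjE conjE) (simp add: z; blast)+
qed

lemma special_in_index: "(sq + 2, sm) \<in> index" "(0, 0) \<in> index"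
  using sm_less sq_less by (auto simp: index_def)

lemma factor_subset:
  assumes "z \<in> index" "z \<noteq> (0, 0)" "z \<noteq> (sq + 2, sm)"
  shows "factor z \<subseteq> base z"
proof -
  obtain l m where z: "z = (l, m)" by (cases z)
  consider "l = 1" "m < x - 1" | "2 \<le> l" using assms(1,2) by (auto simp: index_def z)
  then show ?thesis
  proof cases
    case 1
    then show ?thesis using walecki_subset[of m] by (simp add: factor_def base_def z)
  next
    case 2
    then have "l \<noteq> 0" "l \<noteq> 1" by auto
    then show ?thesis using assms(3) UN_cyc_bipath_subset[where q = "l - 2" and m = m]
      unfolding factor_def base_def z by (simp only: prod.case prod.inject if_False)
  qed
qed

lemma special_subset:
  "factor (0, 0) \<subseteq> (base (0, 0) - swap_in) \<union> swap_out"
  "factor (sq + 2, sm) \<subseteq> (base (sq + 2, sm) - swap_out) \<union> swap_in"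
  "swap_in \<subseteq> base (0, 0)" "swap_out \<subseteq> base (sq + 2, sm)"
  using cut_hex2_subset switched_piece_subset swap_in_subset swap_out_subset
  by (simp_all add: factor_def base_def)

lemma cycle_factor_factor:
  assumes "z \<in> index"
  shows "cycle_factor (2 * x) {..<6 * x} (factor z)"
  using cycle_factor_cut_hex2 cycle_factor_switched_piece cycle_factor_walecki cycle_factor_bipath
  by (cases z) (simp add: factor_def)

text \<open>Every traded edge is removed from the class that owned it, so the two switched factors
  stay disjoint. Both remain inside the union of their two classes, hence avoid all other
  factors.\<close>

lemma disjoint_factor: "disjoint_family_on factor index"
  unfolding disjoint_family_on_def
proof (intro ballI impI)
  fix z z' assume z: "z \<in> index" "z' \<in> index" "z \<noteq> z'"
  let ?o = "(0, 0)" and ?p = "(sq + 2, sm)"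
  have dis: "base y \<inter> base y' = {}" if "y \<in> index" "y' \<in> index" "y \<noteq> y'" for y y'
    using base_disjoint[OF that(1,2)] that(3) by blast
  have op: "factor ?o \<inter> factor ?p = {}"
    using special_subset dis[OF special_in_index(2,1)] by (simp del: add_2_eq_Suc') blast
  have oth: "factor ?o \<inter> factor y = {}" "factor ?p \<inter> factor y = {}"
    if "y \<in> index" "y \<noteq> ?o" "y \<noteq> ?p" for y
    using special_subset factor_subset[OF that]
      dis[OF special_in_index(2) that(1)] dis[OF special_in_index(1) that(1)] that(2,3) by blast+
  have rest: "factor y \<inter> factor y' = {}"
    if "y \<in> index" "y \<noteq> ?o" "y \<noteq> ?p" "y' \<in> index" "y' \<noteq> ?o" "y' \<noteq> ?p" "y \<noteq> y'" for y y'
    using factor_subset[of y] factor_subset[of y'] dis[of y y'] that by blast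
  show "factor z \<inter> factor z' = {}"
    using z op oth rest by (cases "z = ?o"; cases "z = ?p"; cases "z' = ?o"; cases "z' = ?p") blast+
qed

lemma hex1_disjoint:
  assumes "z \<in> index"
  shows "(\<Union>t\<in>{..<x}. cyc 6 (hex1 t)) \<inter> factor z = {}"
proof -
  have b: "base_hex hex1_arcs \<inter> base y = {}" if yi: "y \<in> index" for y
  proof -
    obtain l m where y: "y = (l, m)" by (cases y)
    consider "l = 0" | "l = 1" | "2 \<le> l" "l - 2 < 4" "m < (x - 1) div 2"
      using yi by (force simp: index_def y)
    then show ?thesis
    proof cases
      case 3
      then show ?thesis using base_piece_hex_disjoint[OF _ _ hex_arcs_subset(1), of _ "l - 2" m]
        by (auto simp: base_def y)
    next
      case 2
      then show ?thesis using base_group_hex_disjoint[OF hex_arcs_subset(1)]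
        unfolding base_def y by auto
    qed (use base_hex_disjoint in \<open>simp add: base_def y\<close>)
  qed
  have "factor z \<subseteq> base z \<union> base (0, 0) \<union> base (sq + 2, sm)"
    using factor_subset[OF assms] special_subset
    by (cases "z = (0, 0)"; cases "z = (sq + 2, sm)") blast+
  then show ?thesis using b[OF assms] b[OF special_in_index(1)] b[OF special_in_index(2)] hex1_subset
    by blast
qed

lemma solution: "\<exists>F G. HWP_solution (6 * x) 6 (2 * x) 1 (3 * x - 2) F G"
proof (rule HWP_solutionI)
  show "cycle_factor 6 {..<6 * x} (\<Union>t\<in>{..<x}. cyc 6 (hex1 t))" by (rule cycle_factor_hex1)
  show "cycle_factor (2 * x) {..<6 * x} (factor z)" if "z \<in> index" for z
    using that by (rule cycle_factor_factor)
  show "6 * x = 2 * (3 * x - 2) + 4" using x_ge by simp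
qed (use card_index disjoint_factor hex1_disjoint in auto)

end

theorem theorem8:
  fixes x :: nat
  assumes "x \<ge> 5" and "x mod 6 = 1 \<or> x mod 6 = 5"
  shows "\<exists>F G. HWP_solution (6 * x) 6 (2 * x) 1 (3 * x - 2) F G"
  using assms(2)
proof
  assume "x mod 6 = 1"
  \<comment> \<open>Here \<open>2 * x - 1\<close> is 1 modulo 6, so it lies in column 1.\<close>
  then interpret switching x 1 "(2 * x - 2) div 6" "- 1"
    using assms(1) by unfold_locales (presburger | simp)+
  show ?thesis by (rule solution)
next
  assume "x mod 6 = 5"
  \<comment> \<open>Here \<open>2 * x - 1\<close> is 3 modulo 6, so it lies in column 3.\<close>
  then interpret switching x 3 "(2 * x - 4) div 6" 1
    using assms(1) by unfold_locales (presburger | simp)+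
  show ?thesis by (rule solution)
qed

end
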